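(* Let $a>0$ and $b\ge1$, and let $a_{cr}=(b^2-1)^{-1}$. The equilibrium measure on $\mathbb{R}$ in the external field $$V(x)=\frac{1+a}{2}\log(x^2+b^{-2})-\frac a2\log(x^2+b^2)$$ is the probability measure $\mu_V$ on $\mathbb{R}$ described as follows. (i) If $a\le a_{cr}$, then $\mu_V$ is the probability measure supported on the full real line with density $$\frac{d\mu_V}{dx}=\frac{(1+a-b^2a)x^2+b^2+b^2a-a}{\pi b(x^2+b^2)(x^2+b^{-2})},\qquad x\in\mathbb{R}.$$ (ii) If $a>a_{cr}$, then $\mu_V$ is the probability measure supported on $[-A,A]\subset\mathbb{R}$ with density $$\frac{d\mu_V}{dx}=\frac{\sqrt C\,\sqrt{A^2-x^2}}{\pi(x^2+b^2)(x^2+b^{-2})},\qquad x\in[-A,A],$$ where $$A=\frac{b\sqrt{1+2a}}{\sqrt{b^2a+a+1}\,\sqrt{b^2a-a-1}},\qquad C=\frac{(b^4-1)(b^2a+a+1)(b^2a-a-1)}{b^4}.$$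
   Context: The equilibrium measure in the external field $V$ on $\mathbb{R}$ is the unique minimizer of $$I_V[\mu]=\iint_{\mathbb{R}\times\mathbb{R}}\log\frac1{|x-y|}d\mu(x)d\mu(y)+2\int_{\mathbb{R}} V\,d\mu$$ among probability measures $\mu$ on $\mathbb{R}$, where $I_V[\mu]$ is understood as $\iint\left[\log\frac1{|x-y|}+V(x)+V(y)\right]d\mu(x)d\mu(y)$ when the integrals are not separately defined. Convention: $a_{cr}=+\infty$ if $b=1$ (so that case (i) always applies when $b=1$). *)

theory Defs
  imports "HOL-Probability.Probability"
begin

text \<open>\<open>e2ennreal\<close> truncates negative values to \<open>0\<close>, so this is the integral of the positive part.\<close>
definition pos_integral :: "'a measure \<Rightarrow> ('a \<Rightarrow> ereal) \<Rightarrow> ennreal" where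
  "pos_integral M f = (\<integral>\<^sup>+ x. e2ennreal (f x) \<partial>M)"

definition integral_defined :: "'a measure \<Rightarrow> ('a \<Rightarrow> ereal) \<Rightarrow> bool" where
  "integral_defined M f \<longleftrightarrow>
     pos_integral M f < \<infinity> \<or> pos_integral M (\<lambda>x. - f x) < \<infinity>"

text \<open>
  Meaningful only if \<open>integral_defined\<close> holds, since \<open>\<infinity> - \<infinity> = \<infinity>\<close> in \<open>ereal\<close>. If the external field
  satisfies \<open>V x \<ge> ln (1 + x\<^sup>2) / 2 - c\<close> for a constant \<open>c\<close>, then the combined kernel used below is
  bounded from below, so its integral against a probability measure is always defined.
\<close>
definition ereal_integral :: "'a measure \<Rightarrow> ('a \<Rightarrow> ereal) \<Rightarrow> ereal" where
  "ereal_integral M f =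
     enn2ereal (pos_integral M f) - enn2ereal (pos_integral M (\<lambda>x. - f x))"

text \<open>
  The value on the diagonal has to be fixed explicitly as \<open>\<infinity>\<close>, since in HOL
  \<open>ln (1 / 0) = 0\<close>; measures with atoms would otherwise have finite energy.
\<close>
definition log_kernel :: "real \<Rightarrow> real \<Rightarrow> ereal" where
  "log_kernel x y = (if x = y then \<infinity> else ereal (ln (1 / \<bar>x - y\<bar>)))"

text \<open>
  The energy is the sum of the logarithmic energy and the field term whenever both are defined
  as elements of \<open>[-\<infinity>, \<infinity>]\<close> and their sum is not of the form \<open>\<infinity> - \<infinity>\<close>; otherwise it is the
  integral of the combined kernel.
\<close>
definition weighted_energy :: "(real \<Rightarrow> real) \<Rightarrow> real measure \<Rightarrow> ereal" where
  "weighted_energy V \<mu> =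
     (let L = ereal_integral (\<mu> \<Otimes>\<^sub>M \<mu>) (\<lambda>(x, y). log_kernel x y);
          W = ereal_integral \<mu> (\<lambda>x. ereal (V x))
      in if integral_defined (\<mu> \<Otimes>\<^sub>M \<mu>) (\<lambda>(x, y). log_kernel x y)
            \<and> integral_defined \<mu> (\<lambda>x. ereal (V x))
            \<and> \<not> (L = \<infinity> \<and> W = - \<infinity>) \<and> \<not> (L = - \<infinity> \<and> W = \<infinity>)
         then L + 2 * W
         else ereal_integral (\<mu> \<Otimes>\<^sub>M \<mu>)
                (\<lambda>(x, y). log_kernel x y + ereal (V x) + ereal (V y)))"

definition borel_prob_measures :: "real measure set" where
  "borel_prob_measures = {\<mu>. prob_space \<mu> \<and> sets \<mu> = sets borel}"

definition is_energy_minimizer :: "(real \<Rightarrow> real) \<Rightarrow> real measure \<Rightarrow> bool" where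
  "is_energy_minimizer V \<mu> \<longleftrightarrow>
     \<mu> \<in> borel_prob_measures \<and>
     (\<forall>\<nu> \<in> borel_prob_measures. weighted_energy V \<mu> \<le> weighted_energy V \<nu>)"

definition is_equilibrium_measure :: "(real \<Rightarrow> real) \<Rightarrow> real measure \<Rightarrow> bool" where
  "is_equilibrium_measure V \<mu> \<longleftrightarrow>
     is_energy_minimizer V \<mu> \<and> (\<forall>\<nu>. is_energy_minimizer V \<nu> \<longrightarrow> \<nu> = \<mu>)"

definition measure_support :: "'a::topological_space measure \<Rightarrow> 'a set" where
  "measure_support \<mu> = {x. \<forall>U. open U \<and> x \<in> U \<longrightarrow> emeasure \<mu> U > 0}"

definition external_field :: "real \<Rightarrow> real \<Rightarrow> real \<Rightarrow> real" where
  "external_field a b x =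
     (1 + a) / 2 * ln (x\<^sup>2 + 1 / b\<^sup>2) - a / 2 * ln (x\<^sup>2 + b\<^sup>2)"

definition a_cr :: "real \<Rightarrow> ereal" where
  "a_cr b = (if b = 1 then \<infinity> else ereal (1 / (b\<^sup>2 - 1)))"

definition cut_endpoint :: "real \<Rightarrow> real \<Rightarrow> real" where
  "cut_endpoint a b =
     b * sqrt (1 + 2 * a) / (sqrt (b\<^sup>2 * a + a + 1) * sqrt (b\<^sup>2 * a - a - 1))"

definition cut_constant :: "real \<Rightarrow> real \<Rightarrow> real" where
  "cut_constant a b =
     (b ^ 4 - 1) * (b\<^sup>2 * a + a + 1) * (b\<^sup>2 * a - a - 1) / b ^ 4"

definition full_density :: "real \<Rightarrow> real \<Rightarrow> real \<Rightarrow> real" where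
  "full_density a b x =
     ((1 + a - b\<^sup>2 * a) * x\<^sup>2 + b\<^sup>2 + b\<^sup>2 * a - a)
       / (pi * b * (x\<^sup>2 + b\<^sup>2) * (x\<^sup>2 + 1 / b\<^sup>2))"

definition cut_density :: "real \<Rightarrow> real \<Rightarrow> real \<Rightarrow> real" where
  "cut_density a b x =
     (if x \<in> {- cut_endpoint a b .. cut_endpoint a b}
      then sqrt (cut_constant a b) * sqrt ((cut_endpoint a b)\<^sup>2 - x\<^sup>2)
             / (pi * (x\<^sup>2 + b\<^sup>2) * (x\<^sup>2 + 1 / b\<^sup>2))
      else 0)"

end

theory Submission
  imports Defs "HOL-Real_Asymp.Real_Asymp"
begin

text \<open>
  The logarithmic kernel is represented through a family of sets \<open>S\<^sub>p\<close>: up to bounded corrections,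
  \<open>- ln \<bar>x - y\<bar> + ln (1 + \<bar>x\<bar>) + ln (1 + \<bar>y\<bar>)\<close> is the measure of the set of all \<open>p\<close> with
  \<open>x, y \<in> S\<^sub>p\<close>. Here \<open>p\<close> runs through the intervals \<open>(u - r, u]\<close> with weight \<open>1 / r\<^sup>2\<close>, and \<open>S\<^sub>p\<close> is the
  interval itself or, if it is long and contains \<open>0\<close>, its complement. Hence the mutual energy of
  two probability measures is \<open>\<integral> \<nu>(S\<^sub>p) \<mu>(S\<^sub>p) dp\<close>, the energy of \<open>\<nu> - \<mu>\<close> is
  \<open>\<integral> (\<nu>(S\<^sub>p) - \<mu>(S\<^sub>p))\<^sup>2 dp \<ge> 0\<close>, and it vanishes only for \<open>\<nu> = \<mu>\<close>. Therefore a measure is the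
  equilibrium measure as soon as its effective potential is constant on its support and nowhere
  smaller than that constant.

  The potential of the Cauchy density with scale \<open>c\<close> is \<open>ln (x\<^sup>2 + c\<^sup>2) / 2\<close>. The full density is the
  combination \<open>1 + a\<close> times scale \<open>1 / b\<close> minus \<open>a\<close> times scale \<open>b\<close>, so its potential cancels the field
  exactly. The substitution \<open>y = A t / sqrt (1 + t\<^sup>2)\<close> turns the density on \<open>[- A, A]\<close> into such a
  combination as well, now with scales \<open>\<theta> / (1 + a)\<close> and \<open>\<theta> / a\<close>.
\<close>

section \<open>Potentials of Cauchy densities\<close>

text \<open>The field grows only like \<open>ln \<bar>x\<bar>\<close>, so a competing measure may
  have an infinite logarithmic moment. Its logarithmic energy and its field term then cannot be
  treated separately, and differences of energies need not make sense. The remedy is to move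
  \<open>ln_weight\<close> from the field into the kernel. The new kernel is nonnegative, so mutual
  energies always exist in \<open>ennreal\<close>. The remaining field \<open>V - ln_weight\<close>
  is bounded, hence integrable against every probability measure. Identities between energies are
  stated as sums, never as differences, and therefore hold for infinite energies too.

  On the interval, the substitution is y = A sin \<phi> with t = tan \<phi>, which turns the square
  root in the density into a power of 1 + t^2. The weights \<open>1 + a\<close> and \<open>a\<close>
  and the two new scales satisfy \<open>(1 + a) * c\<^sub>1 = a * c\<^sub>2\<close>. This one
  relation does double duty: it removes the inverse square root singularity at the endpoints, which
  fixes A, and it yields the inequality for the effective potential outside the interval.\<close>

lemma has_bochner_integral_FTC_UNIV:
  fixes f F :: "real \<Rightarrow> real"
  assumes F: "\<And>x. (F has_real_derivative f x) (at x)"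
    and cont: "\<And>x. isCont f x" and nonneg: "\<And>x. 0 \<le> f x"
    and bot: "(F \<longlongrightarrow> l) at_bot" and top: "(F \<longlongrightarrow> u) at_top"
  shows "has_bochner_integral lborel f (u - l)"
proof -
  have "((F \<circ> real_of_ereal) \<longlongrightarrow> l) (at_right (-\<infinity>))"
       "((F \<circ> real_of_ereal) \<longlongrightarrow> u) (at_left \<infinity>)"
    using bot top by (simp_all add: ereal_tendsto_simps)
  from interval_integral_FTC_nonneg[OF _ F cont _ this] nonneg
  show ?thesis
    by (simp add: has_bochner_integral_iff interval_integral_to_infinity_eq set_integrable_def
        interval_lebesgue_integral_def set_lebesgue_integral_def)
qed

definition cauchy_density :: "real \<Rightarrow> real \<Rightarrow> real" where
  "cauchy_density c t = c / (pi * (t\<^sup>2 + c\<^sup>2))"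

lemma cauchy_density_nonneg: "c > 0 \<Longrightarrow> 0 \<le> cauchy_density c t"
  by (simp add: cauchy_density_def)

lemma borel_measurable_cauchy_density [measurable]: "cauchy_density c \<in> borel_measurable borel"
  unfolding cauchy_density_def by measurable

lemma sum_squares_pos: "c > 0 \<Longrightarrow> 0 < (t::real)\<^sup>2 + c\<^sup>2"
  by (simp add: add_nonneg_pos)

lemma has_bochner_integral_cauchy_density:
  assumes "c > 0"
  shows "has_bochner_integral lborel (cauchy_density c) 1"
proof -
  define F where "F = (\<lambda>t. arctan (t / c) / pi)"
  have "has_bochner_integral lborel (cauchy_density c) (1/2 - (-1/2))"
  proof (rule has_bochner_integral_FTC_UNIV[where F = F])
    show "(F has_real_derivative cauchy_density c t) (at t)" for t
    proof -
      have "((\<lambda>t. arctan (t / c)) has_real_derivative c / (t\<^sup>2 + c\<^sup>2)) (at t)"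
        using assms sum_squares_pos[OF assms, of t]
        by (auto intro!: derivative_eq_intros simp: field_simps power2_eq_square)
      from DERIV_cdivide[OF this, of pi] show ?thesis
        unfolding F_def cauchy_density_def by (simp add: mult.commute)
    qed
    show "isCont (cauchy_density c) t" for t
      unfolding cauchy_density_def using sum_squares_pos[OF assms, of t]
      by (auto intro!: continuous_intros)
    show "(F \<longlongrightarrow> -1/2) at_bot" "(F \<longlongrightarrow> 1/2) at_top"
      unfolding F_def using assms by real_asymp+
  qed (use assms cauchy_density_nonneg in auto)
  then show ?thesis by simp
qed

text \<open>Up to a factor pi this is the semigroup law of the Cauchy densities, obtained from an
  explicit antiderivative. For x = 0 and s = c the two quadratic denominators coincide and the
  partial fractions degenerate; later integrations over s lose only a null set by this
  exclusion.\<close>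

lemma has_bochner_integral_cauchy_density_mult:
  assumes c: "c > 0" and s: "s > 0" and nz: "x \<noteq> 0 \<or> s \<noteq> c"
  shows "has_bochner_integral lborel (\<lambda>t. cauchy_density c t * (s / ((t - x)\<^sup>2 + s\<^sup>2)))
           ((s + c) / (x\<^sup>2 + (s + c)\<^sup>2))"
proof -
  \<comment> \<open>\<open>D\<close> is the resultant of the two denominators, and
    \<open>\<alpha>\<close>, \<open>\<beta>\<close>, \<open>\<gamma>\<close> are the partial
    fraction coefficients: the reciprocal of the product is \<open>\<alpha> * t + \<beta>\<close>
    over the first denominator plus \<open>\<gamma> - \<alpha> * (t - x)\<close> over the
    second.\<close>
  define q where "q = x\<^sup>2 + s\<^sup>2 - c\<^sup>2"
  define D where "D = q\<^sup>2 + 4 * x\<^sup>2 * c\<^sup>2"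
  have D_eq: "D = (x\<^sup>2 + (s + c)\<^sup>2) * (x\<^sup>2 + (s - c)\<^sup>2)"
    unfolding D_def q_def by (simp add: power2_eq_square algebra_simps)
  have pos1: "0 < x\<^sup>2 + (s + c)\<^sup>2" using c s by (simp add: add_nonneg_pos)
  have pos2: "0 < x\<^sup>2 + (s - c)\<^sup>2" using nz 
    by (metis add_nonneg_pos add_pos_nonneg eq_iff_diff_eq_0 zero_le_power2 zero_less_power2)
  have D0: "D > 0" using pos1 pos2 by (simp add: D_eq)
  define \<alpha> \<beta> \<gamma> where "\<alpha> = 2 * x / D" and "\<beta> = q / D" and "\<gamma> = (2 * x\<^sup>2 - q) / D"
  define F where "F = (\<lambda>t. c * s / pi * (\<alpha> / 2 * (ln (t\<^sup>2 + c\<^sup>2) - ln ((t - x)\<^sup>2 + s\<^sup>2))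
     + \<beta> / c * arctan (t / c) + \<gamma> / s * arctan ((t - x) / s)))"
  define L where "L = c * s / pi * (pi / 2 * (\<beta> / c + \<gamma> / s))"
  have p1: "0 < t\<^sup>2 + c\<^sup>2" and p2: "0 < (t - x)\<^sup>2 + s\<^sup>2" for t
    using sum_squares_pos[OF c] sum_squares_pos[OF s] by auto
  have pf: "(\<alpha> * t + \<beta>) * ((t - x)\<^sup>2 + s\<^sup>2) + (\<gamma> - \<alpha> * (t - x)) * (t\<^sup>2 + c\<^sup>2) = 1" for t
  proof -
    have "D * ((\<alpha> * t + \<beta>) * ((t - x)\<^sup>2 + s\<^sup>2) + (\<gamma> - \<alpha> * (t - x)) * (t\<^sup>2 + c\<^sup>2)) =
        (2 * x * t + q) * ((t - x)\<^sup>2 + s\<^sup>2) + (2 * x\<^sup>2 - q - 2 * x * (t - x)) * (t\<^sup>2 + c\<^sup>2)"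
      using D0 by (simp add: \<alpha>_def \<beta>_def \<gamma>_def field_simps)
    also have "\<dots> = D * 1" unfolding D_def q_def by (simp add: power2_eq_square algebra_simps)
    finally show ?thesis using D0 by (simp only: mult_left_cancel[OF less_imp_neq[OF D0, symmetric]])
  qed
  have "has_bochner_integral lborel (\<lambda>t. cauchy_density c t * (s / ((t - x)\<^sup>2 + s\<^sup>2))) (L - (- L))"
  proof (rule has_bochner_integral_FTC_UNIV[where F = F])
    fix t
    have a1: "((\<lambda>t. arctan (t / c)) has_real_derivative c / (t\<^sup>2 + c\<^sup>2)) (at t)"
      using c p1[of t] by (auto intro!: derivative_eq_intros simp: field_simps power2_eq_square)
    have a2: "((\<lambda>t. arctan ((t - x) / s)) has_real_derivative s / ((t - x)\<^sup>2 + s\<^sup>2)) (at t)"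
      using s p2[of t] by (auto intro!: derivative_eq_intros simp: field_simps power2_eq_square)
    have a3: "((\<lambda>t. ln (t\<^sup>2 + c\<^sup>2)) has_real_derivative 2 * t / (t\<^sup>2 + c\<^sup>2)) (at t)"
      using p1[of t] by (auto intro!: derivative_eq_intros simp: field_simps)
    have a4: "((\<lambda>t. ln ((t - x)\<^sup>2 + s\<^sup>2)) has_real_derivative 2 * (t - x) / ((t - x)\<^sup>2 + s\<^sup>2)) (at t)"
      using p2[of t] by (auto intro!: derivative_eq_intros simp: field_simps)
    have "(F has_real_derivative c * s / pi * (\<alpha> / 2 * (2 * t / (t\<^sup>2 + c\<^sup>2) - 2 * (t - x) / ((t - x)\<^sup>2 + s\<^sup>2))
       + \<beta> / c * (c / (t\<^sup>2 + c\<^sup>2)) + \<gamma> / s * (s / ((t - x)\<^sup>2 + s\<^sup>2)))) (at t)"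
      unfolding F_def by (intro DERIV_cmult DERIV_add DERIV_diff a1 a2 a3 a4)
    also have "c * s / pi * (\<alpha> / 2 * (2 * t / (t\<^sup>2 + c\<^sup>2) - 2 * (t - x) / ((t - x)\<^sup>2 + s\<^sup>2))
       + \<beta> / c * (c / (t\<^sup>2 + c\<^sup>2)) + \<gamma> / s * (s / ((t - x)\<^sup>2 + s\<^sup>2)))
       = c * s / pi * (((\<alpha> * t + \<beta>) * ((t - x)\<^sup>2 + s\<^sup>2) + (\<gamma> - \<alpha> * (t - x)) * (t\<^sup>2 + c\<^sup>2))
            / ((t\<^sup>2 + c\<^sup>2) * ((t - x)\<^sup>2 + s\<^sup>2)))"
    proof -
      have "\<alpha> / 2 * (2 * t / P - 2 * (t - x) / R) + \<beta> / c * (c / P) + \<gamma> / s * (s / R)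
          = ((\<alpha> * t + \<beta>) * R + (\<gamma> - \<alpha> * (t - x)) * P) / (P * R)" if "P > 0" "R > 0" for P R
      proof -
        have "\<alpha> / 2 * (2 * t / P - 2 * (t - x) / R) + \<beta> / c * (c / P) + \<gamma> / s * (s / R)
            = \<alpha> * t / P - \<alpha> * (t - x) / R + \<beta> / P + \<gamma> / R"
          using c s by (simp add: right_diff_distrib)
        also have "\<dots> = ((\<alpha> * t + \<beta>) * R + (\<gamma> - \<alpha> * (t - x)) * P) / (P * R)"
          using that by (simp add: field_simps)
        finally show ?thesis .
      qed
      from this[OF p1 p2] show ?thesis by simp
    qed
    also have "\<dots> = cauchy_density c t * (s / ((t - x)\<^sup>2 + s\<^sup>2))"
      unfolding pf cauchy_density_def by simp
    finally show "(F has_real_derivative cauchy_density c t * (s / ((t - x)\<^sup>2 + s\<^sup>2))) (at t)" .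
    show "isCont (\<lambda>t. cauchy_density c t * (s / ((t - x)\<^sup>2 + s\<^sup>2))) t"
      unfolding cauchy_density_def using p1[of t] p2[of t]
      by (auto intro!: continuous_intros)
    show "0 \<le> cauchy_density c t * (s / ((t - x)\<^sup>2 + s\<^sup>2))"
      using c s cauchy_density_nonneg p2[of t] by simp
  next
    \<comment> \<open>The two logarithms have the same leading behaviour at both ends, so only the
      arctangents contribute to the integral.\<close>
    have l: "((\<lambda>t. ln (t\<^sup>2 + c\<^sup>2) - ln ((t - x)\<^sup>2 + s\<^sup>2)) \<longlongrightarrow> 0) at_bot"
            "((\<lambda>t. ln (t\<^sup>2 + c\<^sup>2) - ln ((t - x)\<^sup>2 + s\<^sup>2)) \<longlongrightarrow> 0) at_top"
      by real_asymp+
    have m: "((\<lambda>t. arctan (t / c)) \<longlongrightarrow> -(pi/2)) at_bot" "((\<lambda>t. arctan (t / c)) \<longlongrightarrow> pi/2) at_top"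
         "((\<lambda>t. arctan ((t - x) / s)) \<longlongrightarrow> -(pi/2)) at_bot" "((\<lambda>t. arctan ((t - x) / s)) \<longlongrightarrow> pi/2) at_top"
      using c s by real_asymp+
    have "(F \<longlongrightarrow> c * s / pi * (\<alpha> / 2 * 0 + \<beta> / c * (-(pi/2)) + \<gamma> / s * (-(pi/2)))) at_bot"
      unfolding F_def by (intro tendsto_intros l m)
    then show "(F \<longlongrightarrow> - L) at_bot" by (simp add: L_def algebra_simps)
    have "(F \<longlongrightarrow> c * s / pi * (\<alpha> / 2 * 0 + \<beta> / c * (pi/2) + \<gamma> / s * (pi/2))) at_top"
      unfolding F_def by (intro tendsto_intros l m)
    then show "(F \<longlongrightarrow> L) at_top" by (simp add: L_def algebra_simps)
  qed
  also have "L - (- L) = s * \<beta> + c * \<gamma>"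
    using c s by (simp add: L_def field_simps)
  also have "\<dots> = (s * q + c * (2 * x\<^sup>2 - q)) / D"
    by (simp add: \<beta>_def \<gamma>_def add_divide_distrib)
  also have "s * q + c * (2 * x\<^sup>2 - q) = (s + c) * (x\<^sup>2 + (s - c)\<^sup>2)"
    unfolding q_def by (simp add: power2_eq_square algebra_simps)
  also have "\<dots> / D = (s + c) / (x\<^sup>2 + (s + c)\<^sup>2)"
    unfolding D_eq by (rule nonzero_mult_divide_mult_cancel_right[OF less_imp_neq[OF pos2, symmetric]])
  finally show ?thesis .
qed

section \<open>Logarithms as integrals of Poisson kernels\<close>

lemma inverse_minus_poisson_nonneg:
  fixes d s :: real
  assumes "s > 0"
  shows "0 \<le> 1 / s - s / (d\<^sup>2 + s\<^sup>2)"
proof -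
  have p: "d\<^sup>2 + s\<^sup>2 > 0" using assms by (rule sum_squares_pos)
  have "1 / s - s / (d\<^sup>2 + s\<^sup>2) = d\<^sup>2 / (s * (d\<^sup>2 + s\<^sup>2))"
    using p less_imp_neq[OF p] assms by (simp add: diff_frac_eq power2_eq_square)
  then show ?thesis using p assms by simp
qed

lemma DERIV_half_ln_sum_squares:
  fixes d c s :: real
  assumes "d\<^sup>2 + (s + c)\<^sup>2 > 0"
  shows "((\<lambda>s. ln (d\<^sup>2 + (s + c)\<^sup>2) / 2) has_real_derivative (s + c) / (d\<^sup>2 + (s + c)\<^sup>2)) (at s)"
proof -
  have "((\<lambda>s. d\<^sup>2 + (s + c)\<^sup>2) has_real_derivative 2 * (s + c)) (at s)"
    by (auto intro!: derivative_eq_intros)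
  from DERIV_cdivide[OF DERIV_chain2[where f = ln, OF DERIV_ln_divide[OF assms] this], of 2]
  have "((\<lambda>s. ln (d\<^sup>2 + (s + c)\<^sup>2) / 2) has_real_derivative
      1 / (d\<^sup>2 + (s + c)\<^sup>2) * (2 * (s + c)) / 2) (at s)" .
  moreover have "1 / P * (2 * y) / 2 = y / P" for P y :: real
    by simp
  ultimately show ?thesis by metis
qed

text \<open>Represents a logarithm through the kernels to which the semigroup law applies. Since
  \<open>s / (d\<^sup>2 + s\<^sup>2)\<close> decays only like 1 / s, the term \<open>1 / s\<close>
  is needed for convergence at infinity; it also makes the integrand nonnegative, as Tonelli
  requires.\<close>

lemma nn_integral_inverse_minus_poisson:
  fixes d \<kappa> :: real
  assumes "\<kappa> > 0"
  shows "(\<integral>\<^sup>+ s. ennreal (1 / s - s / (d\<^sup>2 + s\<^sup>2)) * indicator {\<kappa>..} s \<partial>lborel)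
           = ennreal (ln (d\<^sup>2 + \<kappa>\<^sup>2) / 2 - ln \<kappa>)"
proof -
  have "(\<integral>\<^sup>+ s. ennreal (1 / s - s / (d\<^sup>2 + s\<^sup>2)) * indicator {\<kappa>..} s \<partial>lborel)
           = ennreal (0 - (ln \<kappa> - ln (d\<^sup>2 + \<kappa>\<^sup>2) / 2))"
  proof (rule nn_integral_FTC_atLeast[where F = "\<lambda>s. ln s - ln (d\<^sup>2 + s\<^sup>2) / 2"])
    fix s assume "\<kappa> \<le> s"
    then have s: "s > 0" using assms by simp
    note p = sum_squares_pos[OF s, of d]
    show "((\<lambda>s. ln s - ln (d\<^sup>2 + s\<^sup>2) / 2) has_real_derivative 1 / s - s / (d\<^sup>2 + s\<^sup>2)) (at s)"
      using DERIV_diff[OF DERIV_ln_divide[OF s] DERIV_half_ln_sum_squares[of d s 0]] p by simp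
    show "0 \<le> 1 / s - s / (d\<^sup>2 + s\<^sup>2)"
      by (rule inverse_minus_poisson_nonneg[OF s])
  next
    show "((\<lambda>s. ln s - ln (d\<^sup>2 + s\<^sup>2) / 2) \<longlongrightarrow> 0) at_top"
      by real_asymp
  qed simp
  then show ?thesis by simp
qed

lemma nn_integral_poisson_Icc:
  fixes d \<kappa> :: real
  assumes "\<kappa> \<ge> 0" "d \<noteq> 0"
  shows "(\<integral>\<^sup>+ s. ennreal (s / (d\<^sup>2 + s\<^sup>2)) * indicator {0..\<kappa>} s \<partial>lborel)
           = ennreal (ln (d\<^sup>2 + \<kappa>\<^sup>2) / 2 - ln (d\<^sup>2) / 2)"
proof -
  have "(\<integral>\<^sup>+ s. ennreal (s / (d\<^sup>2 + s\<^sup>2)) * indicator {0..\<kappa>} s \<partial>lborel)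
           = ennreal (ln (d\<^sup>2 + \<kappa>\<^sup>2) / 2 - ln (d\<^sup>2 + 0\<^sup>2) / 2)"
  proof (rule nn_integral_FTC_Icc[where F = "\<lambda>s. ln (d\<^sup>2 + s\<^sup>2) / 2"])
    fix s :: real assume "s \<in> {0..\<kappa>}"
    have p: "d\<^sup>2 + s\<^sup>2 > 0" using assms by (simp add: add_pos_nonneg)
    show "((\<lambda>s. ln (d\<^sup>2 + s\<^sup>2) / 2) has_real_derivative s / (d\<^sup>2 + s\<^sup>2)) (at s)"
      using DERIV_half_ln_sum_squares[of d s 0] p by simp
    show "0 \<le> s / (d\<^sup>2 + s\<^sup>2)"
      using p \<open>s \<in> _\<close> by simp
  qed (use assms in simp_all)
  then show ?thesis by simp
qed

lemma nn_integral_cauchy_density_poisson: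
  assumes c: "c > 0" and s: "s > 0" and nz: "x \<noteq> 0 \<or> s \<noteq> c"
  shows "(\<integral>\<^sup>+ t. ennreal (cauchy_density c t * (s / ((t - x)\<^sup>2 + s\<^sup>2))) \<partial>lborel)
           = ennreal ((s + c) / (x\<^sup>2 + (s + c)\<^sup>2))"
    and "(\<integral>\<^sup>+ t. ennreal (cauchy_density c t * (1 / s - s / ((t - x)\<^sup>2 + s\<^sup>2))) \<partial>lborel)
           = ennreal (1 / s - (s + c) / (x\<^sup>2 + (s + c)\<^sup>2))"
proof -
  note h = has_bochner_integral_cauchy_density_mult[OF assms]
  show "(\<integral>\<^sup>+ t. ennreal (cauchy_density c t * (s / ((t - x)\<^sup>2 + s\<^sup>2))) \<partial>lborel)
           = ennreal ((s + c) / (x\<^sup>2 + (s + c)\<^sup>2))"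
    using h c s cauchy_density_nonneg[OF c]
    by (subst nn_integral_eq_integral) (auto simp: has_bochner_integral_iff)
  have "has_bochner_integral lborel (\<lambda>t. cauchy_density c t * (1 / s) - cauchy_density c t * (s / ((t - x)\<^sup>2 + s\<^sup>2)))
      (1 * (1 / s) - (s + c) / (x\<^sup>2 + (s + c)\<^sup>2))"
    by (intro has_bochner_integral_diff has_bochner_integral_mult_left
        has_bochner_integral_cauchy_density c h)
  then have h2: "has_bochner_integral lborel (\<lambda>t. cauchy_density c t * (1 / s - s / ((t - x)\<^sup>2 + s\<^sup>2)))
      (1 / s - (s + c) / (x\<^sup>2 + (s + c)\<^sup>2))"
    by (simp add: right_diff_distrib)
  have "0 \<le> 1 / s - s / ((t - x)\<^sup>2 + s\<^sup>2)" for t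
    by (rule inverse_minus_poisson_nonneg[OF s])
  then show "(\<integral>\<^sup>+ t. ennreal (cauchy_density c t * (1 / s - s / ((t - x)\<^sup>2 + s\<^sup>2))) \<partial>lborel)
           = ennreal (1 / s - (s + c) / (x\<^sup>2 + (s + c)\<^sup>2))"
    using h2 cauchy_density_nonneg[OF c]
    by (subst nn_integral_eq_integral) (auto simp: has_bochner_integral_iff)
qed

text \<open>Integration against the Cauchy density of scale c replaces s by s + c in the Poisson
  kernel. Exchanging the integrals therefore shifts \<kappa> to \<kappa> + c inside the
  logarithm.\<close>

lemma cauchy_log_potential_pos:
  assumes c: "c > 0" and \<kappa>: "\<kappa> > 0"
  shows "has_bochner_integral lborel (\<lambda>t. cauchy_density c t * (ln ((t - x)\<^sup>2 + \<kappa>\<^sup>2) / 2))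
           (ln (x\<^sup>2 + (\<kappa> + c)\<^sup>2) / 2)"
proof -
  let ?h = "\<lambda>t s. 1 / s - s / ((t - x)\<^sup>2 + s\<^sup>2)"
  have le: "0 \<le> ln ((t - x)\<^sup>2 + \<kappa>\<^sup>2) / 2 - ln \<kappa>" for t
  proof -
    have "2 * ln \<kappa> = ln (\<kappa>\<^sup>2)" using \<kappa> by (simp add: ln_realpow)
    also have "\<dots> \<le> ln ((t - x)\<^sup>2 + \<kappa>\<^sup>2)" using \<kappa> by (subst ln_le_cancel_iff) (auto simp: sum_squares_pos)
    finally show ?thesis by simp
  qed
  have "(\<integral>\<^sup>+ t. ennreal (cauchy_density c t * (ln ((t - x)\<^sup>2 + \<kappa>\<^sup>2) / 2 - ln \<kappa>)) \<partial>lborel)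
      = (\<integral>\<^sup>+ t. (\<integral>\<^sup>+ s. ennreal (cauchy_density c t) * (ennreal (?h t s) * indicator {\<kappa>..} s) \<partial>lborel) \<partial>lborel)"
    by (intro nn_integral_cong)
       (simp add: nn_integral_cmult nn_integral_inverse_minus_poisson[OF \<kappa>] ennreal_mult' cauchy_density_nonneg[OF c])
  also have "\<dots> = (\<integral>\<^sup>+ s. (\<integral>\<^sup>+ t. ennreal (cauchy_density c t) * (ennreal (?h t s) * indicator {\<kappa>..} s) \<partial>lborel) \<partial>lborel)"
    by (intro lborel_pair.Fubini') measurable
  also have "\<dots> = (\<integral>\<^sup>+ s. (\<integral>\<^sup>+ t. ennreal (cauchy_density c t * ?h t s) \<partial>lborel) * indicator {\<kappa>..} s \<partial>lborel)"
    by (intro nn_integral_cong)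
       (auto simp: ennreal_mult' cauchy_density_nonneg[OF c] simp del: times_divide_eq_right split: split_indicator)
  also have "\<dots> = (\<integral>\<^sup>+ s. ennreal (1 / s - (s + c) / (x\<^sup>2 + (s + c)\<^sup>2)) * indicator {\<kappa>..} s \<partial>lborel)"
  proof (rule nn_integral_cong_AE)
    \<comment> \<open>The value s = c is discarded, because the semigroup law excludes it when x =
      0.\<close>
    show "AE s in lborel. (\<integral>\<^sup>+ t. ennreal (cauchy_density c t * ?h t s) \<partial>lborel) * indicator {\<kappa>..} s
        = ennreal (1 / s - (s + c) / (x\<^sup>2 + (s + c)\<^sup>2)) * indicator {\<kappa>..} s"
      using AE_lborel_singleton[of c]
    proof eventually_elim
      case (elim s)
      then show ?case
        using nn_integral_cauchy_density_poisson(2)[OF c, of s x] \<kappa> by (auto split: split_indicator)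
    qed
  qed
  also have "\<dots> = ennreal (0 - (ln \<kappa> - ln (x\<^sup>2 + (\<kappa> + c)\<^sup>2) / 2))"
  proof (rule nn_integral_FTC_atLeast[where F = "\<lambda>s. ln s - ln (x\<^sup>2 + (s + c)\<^sup>2) / 2"])
    fix s assume "\<kappa> \<le> s"
    then have s: "s > 0" using \<kappa> by simp
    have p: "x\<^sup>2 + (s + c)\<^sup>2 > 0" using s c by (intro sum_squares_pos) simp
    show "((\<lambda>s. ln s - ln (x\<^sup>2 + (s + c)\<^sup>2) / 2) has_real_derivative 1 / s - (s + c) / (x\<^sup>2 + (s + c)\<^sup>2)) (at s)"
      by (intro DERIV_diff DERIV_ln_divide s DERIV_half_ln_sum_squares p)
    have "s * (s + c) \<le> (s + c) * (s + c)" using s c by (intro mult_right_mono) auto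
    also have "\<dots> \<le> x\<^sup>2 + (s + c)\<^sup>2" by (simp add: power2_eq_square)
    finally show "0 \<le> 1 / s - (s + c) / (x\<^sup>2 + (s + c)\<^sup>2)"
      using s p by (simp add: field_simps)
  next
    show "((\<lambda>s. ln s - ln (x\<^sup>2 + (s + c)\<^sup>2) / 2) \<longlongrightarrow> 0) at_top"
      by real_asymp
  qed simp
  finally have nn: "(\<integral>\<^sup>+ t. ennreal (cauchy_density c t * (ln ((t - x)\<^sup>2 + \<kappa>\<^sup>2) / 2 - ln \<kappa>)) \<partial>lborel)
      = ennreal (ln (x\<^sup>2 + (\<kappa> + c)\<^sup>2) / 2 - ln \<kappa>)" by simp
  have "2 * ln \<kappa> = ln (\<kappa>\<^sup>2)" using \<kappa> by (simp add: ln_realpow)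
  also have "\<dots> \<le> ln (x\<^sup>2 + (\<kappa> + c)\<^sup>2)"
  proof (subst ln_le_cancel_iff)
    have "\<kappa>\<^sup>2 \<le> (\<kappa> + c)\<^sup>2" using \<kappa> c by (intro power_mono) auto
    then show "\<kappa>\<^sup>2 \<le> x\<^sup>2 + (\<kappa> + c)\<^sup>2" by (simp add: add_increasing)
    show "0 < x\<^sup>2 + (\<kappa> + c)\<^sup>2" using \<kappa> c by (intro sum_squares_pos) simp
  qed (use \<kappa> in simp)
  finally have "has_bochner_integral lborel (\<lambda>t. cauchy_density c t * (ln ((t - x)\<^sup>2 + \<kappa>\<^sup>2) / 2 - ln \<kappa>))
      (ln (x\<^sup>2 + (\<kappa> + c)\<^sup>2) / 2 - ln \<kappa>)"
    using nn le cauchy_density_nonneg[OF c]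
    by (intro has_bochner_integral_nn_integral) auto
  from has_bochner_integral_add[OF this has_bochner_integral_mult_left[OF has_bochner_integral_cauchy_density[OF c], of "ln \<kappa>"]]
  show ?thesis by (simp add: algebra_simps)
qed

lemma cauchy_log_potential:
  assumes c: "c > 0" and \<kappa>: "\<kappa> \<ge> 0"
  shows "has_bochner_integral lborel (\<lambda>t. cauchy_density c t * (ln ((t - x)\<^sup>2 + \<kappa>\<^sup>2) / 2))
           (ln (x\<^sup>2 + (\<kappa> + c)\<^sup>2) / 2)"
proof (cases "\<kappa> = 0")
  case False
  with cauchy_log_potential_pos[OF c, of \<kappa> x] \<kappa> show ?thesis by simp
next
  case True
  let ?h = "\<lambda>t s. s / ((t - x)\<^sup>2 + s\<^sup>2)"
  let ?f = "\<lambda>t. ln ((t - x)\<^sup>2 + 1\<^sup>2) / 2 - ln ((t - x)\<^sup>2) / 2"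
  have "(\<integral>\<^sup>+ t. ennreal (cauchy_density c t * ?f t) \<partial>lborel)
      = (\<integral>\<^sup>+ t. (\<integral>\<^sup>+ s. ennreal (cauchy_density c t) * (ennreal (?h t s) * indicator {0..1} s) \<partial>lborel) \<partial>lborel)"
  proof (rule nn_integral_cong_AE)
    show "AE t in lborel. ennreal (cauchy_density c t * ?f t)
        = (\<integral>\<^sup>+ s. ennreal (cauchy_density c t) * (ennreal (?h t s) * indicator {0..1} s) \<partial>lborel)"
      using AE_lborel_singleton[of x]
    proof eventually_elim
      case (elim t)
      then show ?case
        using nn_integral_poisson_Icc[of 1 "t - x"]
        by (simp add: nn_integral_cmult ennreal_mult' cauchy_density_nonneg[OF c])
    qed
  qed
  also have "\<dots> = (\<integral>\<^sup>+ s. (\<integral>\<^sup>+ t. ennreal (cauchy_density c t) * (ennreal (?h t s) * indicator {0..1} s) \<partial>lborel) \<partial>lborel)"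
    by (intro lborel_pair.Fubini') measurable
  also have "\<dots> = (\<integral>\<^sup>+ s. (\<integral>\<^sup>+ t. ennreal (cauchy_density c t * ?h t s) \<partial>lborel) * indicator {0..1} s \<partial>lborel)"
    by (intro nn_integral_cong)
       (auto simp: ennreal_mult' cauchy_density_nonneg[OF c] simp del: times_divide_eq_right split: split_indicator)
  also have "\<dots> = (\<integral>\<^sup>+ s. ennreal ((s + c) / (x\<^sup>2 + (s + c)\<^sup>2)) * indicator {0..1} s \<partial>lborel)"
  proof (rule nn_integral_cong_AE)
    show "AE s in lborel. (\<integral>\<^sup>+ t. ennreal (cauchy_density c t * ?h t s) \<partial>lborel) * indicator {0..1} s
        = ennreal ((s + c) / (x\<^sup>2 + (s + c)\<^sup>2)) * indicator {0..1} s"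
      using AE_lborel_singleton[of c] AE_lborel_singleton[of 0]
    proof eventually_elim
      case (elim s)
      then show ?case
        using nn_integral_cauchy_density_poisson(1)[OF c, of s x] by (auto split: split_indicator)
    qed
  qed
  also have "\<dots> = ennreal (ln (x\<^sup>2 + (1 + c)\<^sup>2) / 2 - ln (x\<^sup>2 + (0 + c)\<^sup>2) / 2)"
  proof (rule nn_integral_FTC_Icc[where F = "\<lambda>s. ln (x\<^sup>2 + (s + c)\<^sup>2) / 2"])
    fix s :: real assume "s \<in> {0..1}"
    then have p: "x\<^sup>2 + (s + c)\<^sup>2 > 0" using c by (intro sum_squares_pos) simp
    show "((\<lambda>s. ln (x\<^sup>2 + (s + c)\<^sup>2) / 2) has_real_derivative (s + c) / (x\<^sup>2 + (s + c)\<^sup>2)) (at s)"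
      by (rule DERIV_half_ln_sum_squares[OF p])
    show "0 \<le> (s + c) / (x\<^sup>2 + (s + c)\<^sup>2)" using p c \<open>s \<in> _\<close> by simp
  qed simp_all
  finally have nn: "(\<integral>\<^sup>+ t. ennreal (cauchy_density c t * ?f t) \<partial>lborel)
      = ennreal (ln (x\<^sup>2 + (1 + c)\<^sup>2) / 2 - ln (x\<^sup>2 + c\<^sup>2) / 2)" by simp
  have "AE t in lborel. 0 \<le> cauchy_density c t * ?f t"
    using AE_lborel_singleton[of x]
  proof eventually_elim
    case (elim t)
    then have "ln ((t - x)\<^sup>2) \<le> ln ((t - x)\<^sup>2 + 1\<^sup>2)"
      by (subst ln_le_cancel_iff) (auto intro: add_pos_pos)
    then show ?case using cauchy_density_nonneg[OF c] by (intro mult_nonneg_nonneg) auto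
  qed
  moreover have "ln (x\<^sup>2 + c\<^sup>2) \<le> ln (x\<^sup>2 + (1 + c)\<^sup>2)"
  proof (subst ln_le_cancel_iff)
    show "x\<^sup>2 + c\<^sup>2 \<le> x\<^sup>2 + (1 + c)\<^sup>2" using c by (intro add_left_mono power_mono) auto
  qed (use c in \<open>auto intro!: sum_squares_pos\<close>)
  ultimately have "has_bochner_integral lborel (\<lambda>t. cauchy_density c t * ?f t)
      (ln (x\<^sup>2 + (1 + c)\<^sup>2) / 2 - ln (x\<^sup>2 + c\<^sup>2) / 2)"
    using nn by (intro has_bochner_integral_nn_integral) auto
  from has_bochner_integral_diff[OF cauchy_log_potential_pos[OF c zero_less_one, of x] this] True
  show ?thesis by (simp add: algebra_simps)
qed

section \<open>The logarithmic kernel as a measure of sets\<close>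

text \<open>
  This is \<open>\<integral> min r \<bar>x\<bar> / r\<^sup>2 dr\<close> over \<open>r > 1\<close> and differs from \<open>ln (1 + \<bar>x\<bar>)\<close> by a bounded function.
\<close>

definition ln_weight :: "real \<Rightarrow> real" where
  "ln_weight x = \<bar>x\<bar> / max 1 \<bar>x\<bar> + ln (max 1 \<bar>x\<bar>)"

lemma ln_weight_nonneg: "0 \<le> ln_weight x"
  by (simp add: ln_weight_def)

lemma borel_measurable_ln_weight [measurable]: "ln_weight \<in> borel_measurable borel"
  unfolding ln_weight_def by measurable

text \<open>Without the complement, the long intervals containing both x and y would have infinite
  weight. For r > 1 the complement ensures that 0 is never in the set, so the admissible values of u
  have bounded measure as r grows and the weight 1 / r^2 is integrable at infinity. For two
  probability measures, passing to the complement only changes the sign of the difference of the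
  masses, so squares of differences are unaffected.\<close>

definition flipped_interval :: "real \<times> real \<Rightarrow> real set" where
  "flipped_interval = (\<lambda>(r, u). {x. (1 < r \<and> u - r < 0 \<and> 0 \<le> u) \<noteq> (u - r < x \<and> x \<le> u)})"

definition interval_weight :: "real \<times> real \<Rightarrow> ennreal" where
  "interval_weight = (\<lambda>(r, u). ennreal (1 / r\<^sup>2) * indicator {0<..} r)"

definition pos_kernel :: "real \<Rightarrow> real \<Rightarrow> ennreal" where
  "pos_kernel x y = (\<integral>\<^sup>+ p. interval_weight p *
     (indicator (flipped_interval p) x * indicator (flipped_interval p) y) \<partial>(lborel \<Otimes>\<^sub>M lborel))"

lemma borel_measurable_interval_weight [measurable]:
  "interval_weight \<in> borel_measurable (borel \<Otimes>\<^sub>M borel)"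
  unfolding interval_weight_def by measurable

lemma pred_flipped_interval [measurable]:
  assumes [measurable]: "f \<in> M \<rightarrow>\<^sub>M borel \<Otimes>\<^sub>M borel" "g \<in> borel_measurable M"
  shows "Measurable.pred M (\<lambda>z. g z \<in> flipped_interval (f z))"
  unfolding flipped_interval_def by (simp add: case_prod_beta)

lemma borel_measurable_indicator_flipped_interval [measurable]:
  assumes [measurable]: "f \<in> M \<rightarrow>\<^sub>M borel \<Otimes>\<^sub>M borel" "g \<in> borel_measurable M"
  shows "(\<lambda>z. indicator (flipped_interval (f z)) (g z) :: ennreal) \<in> borel_measurable M"
proof -
  have "(\<lambda>z. indicator (flipped_interval (f z)) (g z) :: ennreal)
      = (\<lambda>z. if g z \<in> flipped_interval (f z) then 1 else 0)"
    by (auto simp: indicator_def)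
  then show ?thesis by simp
qed

lemma sets_flipped_interval [measurable]: "flipped_interval p \<in> sets borel"
proof -
  have "Measurable.pred borel (\<lambda>x. x \<in> flipped_interval ((\<lambda>_. p) x))"
    by (rule pred_flipped_interval) (auto simp: space_pair_measure)
  then show ?thesis by (simp add: pred_def)
qed

section \<open>Evaluation of the kernel, separately for short and long intervals\<close>

lemma has_bochner_integral_min_over_square:
  assumes "e \<ge> 0"
  shows "has_bochner_integral lborel (\<lambda>r. min r e / r\<^sup>2 * indicator {1<..} r) (ln_weight e)"
proof -
  define m where "m = max 1 e"
  have m: "m \<ge> 1" "m \<ge> e" by (auto simp: m_def)
  have 1: "(\<integral>\<^sup>+ r. ennreal (1 / r) * indicator {1..m} r \<partial>lborel) = ennreal (ln m - ln 1)"
    using m by (intro nn_integral_FTC_Icc) (auto intro!: derivative_eq_intros)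
  have 2: "(\<integral>\<^sup>+ r. ennreal (e / r\<^sup>2) * indicator {m..} r \<partial>lborel) = ennreal (0 - (- e / m))"
  proof (rule nn_integral_FTC_atLeast[where F = "\<lambda>r. - e / r"])
    show "((\<lambda>r. - e / r) has_real_derivative e / r\<^sup>2) (at r)" if "m \<le> r" for r
      using m that by (auto intro!: derivative_eq_intros simp: power2_eq_square)
    show "((\<lambda>r. - e / r) \<longlongrightarrow> 0) at_top" by real_asymp
  qed (use assms in auto)
  have "(\<integral>\<^sup>+ r. ennreal (min r e / r\<^sup>2 * indicator {1<..} r) \<partial>lborel)
      = (\<integral>\<^sup>+ r. ennreal (1 / r) * indicator {1..m} r + ennreal (e / r\<^sup>2) * indicator {m..} r \<partial>lborel)"
  proof (rule nn_integral_cong_AE)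
    show "AE r in lborel. ennreal (min r e / r\<^sup>2 * indicator {1<..} r)
        = ennreal (1 / r) * indicator {1..m} r + ennreal (e / r\<^sup>2) * indicator {m..} r"
      using AE_lborel_singleton[of 1] AE_lborel_singleton[of m]
    proof eventually_elim
      case (elim r)
      show ?case
      proof (cases "r > 1")
        case True
        show ?thesis
        proof (cases "r > m")
          case True
          with m have "min r e = e" by simp
          with True m \<open>r > 1\<close> show ?thesis by (simp add: indicator_def)
        next
          case False
          with elim \<open>r > 1\<close> have "e = m" "min r e = r" "r < m"
            by (auto simp: m_def max_def min_def split: if_splits)
          with \<open>r > 1\<close> show ?thesis by (simp add: indicator_def power2_eq_square)
        qed
      qed (use elim m in \<open>auto simp: indicator_def\<close>)
    qed
  qed
  also have "\<dots> = ennreal (ln m - ln 1) + ennreal (0 - (- e / m))"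
    by (subst nn_integral_add) (simp_all only: 1 2, measurable)
  also have "\<dots> = ennreal (ln_weight e)"
    using m assms by (simp add: ln_weight_def m_def add.commute flip: ennreal_plus)
  finally show ?thesis
    using assms ln_weight_nonneg
    by (intro has_bochner_integral_nn_integral) (auto simp: indicator_def)
qed

text \<open>An interval of length r < d contains no two points at distance d, so only r in [d, 1]
  contributes. One formula covers both ranges of d: \<open>ln_weight d\<close> equals d for d \<le>
  1 and 1 + ln d for d \<ge> 1, and in the latter case the value is 0.\<close>

lemma nn_integral_tent_le_1:
  assumes "d > 0"
  shows "(\<integral>\<^sup>+ r. ennreal ((r - min r d) / r\<^sup>2) * indicator {0<..1} r \<partial>lborel)
      = ennreal (ln_weight d - 1 - ln d)" "0 \<le> ln_weight d - 1 - ln d"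
proof -
  show "0 \<le> ln_weight d - 1 - ln d"
    using assms ln_le_minus_one[of d] by (auto simp: ln_weight_def max_def)
  have eq: "ennreal ((r - min r d) / r\<^sup>2) * indicator {0<..1} r
      = ennreal (1 / r - d / r\<^sup>2) * indicator {d..1} r" for r
  proof (cases "r < d")
    case False
    with assms have "(r - min r d) / r\<^sup>2 = 1 / r - d / r\<^sup>2"
      by (simp add: min_def diff_divide_distrib power2_eq_square)
    with False assms show ?thesis by (simp add: indicator_def)
  qed (use assms in \<open>simp add: indicator_def\<close>)
  show "(\<integral>\<^sup>+ r. ennreal ((r - min r d) / r\<^sup>2) * indicator {0<..1} r \<partial>lborel)
      = ennreal (ln_weight d - 1 - ln d)"
  proof (cases "d \<le> 1")
    case True
    have "(\<integral>\<^sup>+ r. ennreal (1 / r - d / r\<^sup>2) * indicator {d..1} r \<partial>lborel)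
        = ennreal ((ln 1 + d / 1) - (ln d + d / d))"
    proof (rule nn_integral_FTC_Icc[where F = "\<lambda>r. ln r + d / r"])
      fix r assume "r \<in> {d..1}"
      with assms have r: "r > 0" "d \<le> r" by auto
      show "((\<lambda>r. ln r + d / r) has_real_derivative 1 / r - d / r\<^sup>2) (at r)"
        using r by (auto intro!: derivative_eq_intros simp: power2_eq_square)
      have "1 / r - d / r\<^sup>2 = (r - d) / r\<^sup>2" using r by (simp add: diff_divide_distrib power2_eq_square)
      with r show "0 \<le> 1 / r - d / r\<^sup>2" by simp
    qed (use True in auto)
    also have "(ln 1 + d / 1) - (ln d + d / d) = ln_weight d - 1 - ln d"
      using True assms by (simp add: ln_weight_def)
    finally show ?thesis by (simp only: eq)
  next
    case False
    then have "{d..1} = {}" by simp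
    then show ?thesis using False by (simp add: eq ln_weight_def)
  qed
qed

text \<open>The divergence of the integral of 1 / r at 0 makes the kernel infinite on the diagonal,
  in agreement with the value prescribed in \<open>log_kernel\<close>.\<close>

lemma nn_integral_tent_0:
  "(\<integral>\<^sup>+ r. ennreal (r / r\<^sup>2) * indicator {0<..1} r \<partial>lborel) = (\<infinity>::ennreal)"
proof -
  have "ennreal B \<le> (\<integral>\<^sup>+ r. ennreal (r / r\<^sup>2) * indicator {0<..1} r \<partial>lborel)" for B :: real
  proof -
    \<comment> \<open>This choice makes the integral of 1 / r over [\<epsilon>, 1] equal to the
      absolute value of B.\<close>
    define \<epsilon> where "\<epsilon> = exp (- \<bar>B\<bar>)"
    have \<epsilon>: "\<epsilon> > 0" "\<epsilon> \<le> 1" by (auto simp: \<epsilon>_def)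
    have "ennreal B \<le> ennreal (ln 1 - ln \<epsilon>)" by (intro ennreal_leI) (simp add: \<epsilon>_def)
    also have "\<dots> = (\<integral>\<^sup>+ r. ennreal (1 / r) * indicator {\<epsilon>..1} r \<partial>lborel)"
      using \<epsilon> by (intro nn_integral_FTC_Icc[symmetric]) (auto intro!: derivative_eq_intros)
    also have "\<dots> \<le> (\<integral>\<^sup>+ r. ennreal (r / r\<^sup>2) * indicator {0<..1} r \<partial>lborel)"
      using \<epsilon> by (intro nn_integral_mono) (auto simp: indicator_def power2_eq_square)
    finally show ?thesis .
  qed
  note * = this
  show ?thesis
  proof (rule ccontr)
    assume "\<not> ?thesis"
    then obtain B where "B \<ge> 0" "(\<integral>\<^sup>+ r. ennreal (r / r\<^sup>2) * indicator {0<..1} r \<partial>lborel) = ennreal B"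
      by (cases "\<integral>\<^sup>+ r. ennreal (r / r\<^sup>2) * indicator {0<..1} r \<partial>lborel") auto
    with *[of "B + 1"] show False by simp
  qed
qed

text \<open>For r > 1, membership of x means that exactly one of 0 and x lies in the interval. With
  \<open>I\<close> as a 0-1 value, the product of the two indicators is (I u 0 - I u x) * (I u 0 - I
  u y), and expanding it reduces everything to plain intervals.\<close>

lemma nn_integral_flipped_interval:
  assumes "r > 0"
  shows "(\<integral>\<^sup>+ u. indicator (flipped_interval (r, u)) x * indicator (flipped_interval (r, u)) y \<partial>lborel)
     = (if 1 < r then ennreal (min r \<bar>x\<bar> + min r \<bar>y\<bar> - min r \<bar>x - y\<bar>) else ennreal (r - min r \<bar>x - y\<bar>))"
proof -
  \<comment> \<open>The u for which both z and w lie in (u - r, u] form this half-open interval; its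
    length is r - \<open>\<bar>z - w\<bar>\<close>, cut off at 0.\<close>
  define J where "J = (\<lambda>z w. indicator {max z w..<min z w + r} :: real \<Rightarrow> real)"
  have J: "has_bochner_integral lborel (J z w) (r - min r \<bar>z - w\<bar>)" for z w
  proof -
    have "min z w + r - max z w = r - \<bar>z - w\<bar>" by (auto simp: min_def max_def)
    then have "measure lborel {max z w..<min z w + r} = r - min r \<bar>z - w\<bar>"
      by (cases "max z w \<le> min z w + r") (auto simp: min_def max_def)
    moreover have "emeasure lborel {max z w..<min z w + r} < \<infinity>"
      by (rule emeasure_bounded_finite, rule bounded_subset[OF bounded_closed_interval[of "max z w" "min z w + r"]]) auto
    then have "has_bochner_integral lborel (J z w) (measure lborel {max z w..<min z w + r})"
      unfolding J_def by (intro has_bochner_integral_real_indicator) auto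
    ultimately show ?thesis by simp
  qed
  define I where "I = (\<lambda>u z. u - r < z \<and> z \<le> u)"
  have J_eq: "J z w u = (if I u z \<and> I u w then 1 else 0)" for z w u
  proof -
    have "u \<in> {max z w..<min z w + r} \<longleftrightarrow> I u z \<and> I u w"
      unfolding I_def by (simp add: min_def) arith
    then show ?thesis by (simp add: J_def)
  qed
  show ?thesis
  proof (cases "1 < r")
    case False
    then have mem: "z \<in> flipped_interval (r, u) \<longleftrightarrow> I u z" for u z
      by (simp add: flipped_interval_def I_def)
    have "(\<integral>\<^sup>+ u. indicator (flipped_interval (r, u)) x * indicator (flipped_interval (r, u)) y \<partial>lborel)
        = (\<integral>\<^sup>+ u. ennreal (J x y u) \<partial>lborel)"
      by (intro nn_integral_cong) (simp add: J_eq mem indicator_def)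
    also have "\<dots> = ennreal (r - min r \<bar>x - y\<bar>)"
      using J[of x y] by (subst nn_integral_eq_integral) (auto simp: has_bochner_integral_iff J_def)
    finally show ?thesis using False by simp
  next
    case True
    then have mem: "z \<in> flipped_interval (r, u) \<longleftrightarrow> (I u 0 \<noteq> I u z)" for u z
      by (simp add: flipped_interval_def I_def)
    \<comment> \<open>The four terms of the expanded product, with the square of I u 0 written as
      \<open>J 0 0 u\<close>.\<close>
    let ?f = "\<lambda>u. J x y u + J 0 0 u - J x 0 u - J y 0 u"
    have f: "?f u = indicator (flipped_interval (r, u)) x * indicator (flipped_interval (r, u)) y" for u
      by (auto simp: J_eq mem indicator_def)
    have i: "has_bochner_integral lborel ?f
        ((r - min r \<bar>x - y\<bar>) + (r - min r \<bar>0 - 0\<bar>) - (r - min r \<bar>x - 0\<bar>) - (r - min r \<bar>y - 0\<bar>))"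
      by (intro has_bochner_integral_diff has_bochner_integral_add J)
    have "(\<integral>\<^sup>+ u. indicator (flipped_interval (r, u)) x * indicator (flipped_interval (r, u)) y \<partial>lborel)
        = (\<integral>\<^sup>+ u. ennreal (?f u) \<partial>lborel)"
      unfolding f by (intro nn_integral_cong) (auto simp: indicator_def)
    also have "\<dots> = ennreal ((r - min r \<bar>x - y\<bar>) + (r - min r \<bar>0 - 0\<bar>) - (r - min r \<bar>x - 0\<bar>) - (r - min r \<bar>y - 0\<bar>))"
      using i by (subst nn_integral_eq_integral) (auto simp: has_bochner_integral_iff f)
    also have "(r - min r \<bar>x - y\<bar>) + (r - min r \<bar>0 - 0\<bar>) - (r - min r \<bar>x - 0\<bar>) - (r - min r \<bar>y - 0\<bar>)
       = min r \<bar>x\<bar> + min r \<bar>y\<bar> - min r \<bar>x - y\<bar>"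
      using assms by simp
    finally show ?thesis using True by simp
  qed
qed

text \<open>The lengths r \<le> 1 contribute \<open>ln_weight d - 1 - ln d\<close> with d the
  distance of x and y, and the lengths r > 1 contribute
  \<open>ln_weight x + ln_weight y - ln_weight d\<close>. The terms \<open>ln_weight d\<close>
  cancel, and the sum is nonnegative because both contributions are.\<close>

lemma pos_kernel_eq:
  "pos_kernel x y = (if x = y then \<infinity> else ennreal (ln_weight x + ln_weight y - 1 - ln \<bar>x - y\<bar>))" (is ?th1)
  and ln_weight_minus_ln_nonneg: "x \<noteq> y \<Longrightarrow> 0 \<le> ln_weight x + ln_weight y - 1 - ln \<bar>x - y\<bar>"
proof -
  let ?d = "\<bar>x - y\<bar>"
  let ?f = "\<lambda>r. min r \<bar>x\<bar> / r\<^sup>2 * indicator {1<..} r + min r \<bar>y\<bar> / r\<^sup>2 * indicator {1<..} r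
        - min r ?d / r\<^sup>2 * indicator {1<..} r :: real"
  have f: "has_bochner_integral lborel ?f (ln_weight \<bar>x\<bar> + ln_weight \<bar>y\<bar> - ln_weight ?d)"
    by (intro has_bochner_integral_add has_bochner_integral_diff has_bochner_integral_min_over_square) auto
  have f_eq: "?f r = (min r \<bar>x\<bar> + min r \<bar>y\<bar> - min r ?d) / r\<^sup>2 * indicator {1<..} r" for r
    by (simp add: add_divide_distrib diff_divide_distrib indicator_def)
  have f_nonneg: "0 \<le> ?f r" for r
    unfolding f_eq by (auto simp: indicator_def)
  have lw: "ln_weight \<bar>z\<bar> = ln_weight z" for z by (simp add: ln_weight_def)
  have w2: "0 \<le> ln_weight x + ln_weight y - ln_weight ?d"
    using f f_nonneg integral_nonneg_AE[where M = lborel and f = ?f] by (simp add: has_bochner_integral_iff lw)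
  have "pos_kernel x y = (\<integral>\<^sup>+ r. \<integral>\<^sup>+ u. interval_weight (r, u) *
     (indicator (flipped_interval (r, u)) x * indicator (flipped_interval (r, u)) y) \<partial>lborel \<partial>lborel)"
    unfolding pos_kernel_def by (rule lborel.nn_integral_fst[symmetric]) measurable
  also have "\<dots> = (\<integral>\<^sup>+ r. ennreal (1 / r\<^sup>2) * indicator {0<..} r * (\<integral>\<^sup>+ u.
     (indicator (flipped_interval (r, u)) x * indicator (flipped_interval (r, u)) y) \<partial>lborel) \<partial>lborel)"
    unfolding interval_weight_def by (intro nn_integral_cong) (simp add: nn_integral_cmult)
  also have "\<dots> = (\<integral>\<^sup>+ r. ennreal ((r - min r ?d) / r\<^sup>2) * indicator {0<..1} r + ennreal (?f r) \<partial>lborel)"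
  proof (intro nn_integral_cong)
    fix r :: real
    show "ennreal (1 / r\<^sup>2) * indicator {0<..} r * (\<integral>\<^sup>+ u.
       (indicator (flipped_interval (r, u)) x * indicator (flipped_interval (r, u)) y) \<partial>lborel)
       = ennreal ((r - min r ?d) / r\<^sup>2) * indicator {0<..1} r + ennreal (?f r)"
    proof (cases "r > 0")
      case True
      then show ?thesis
        unfolding nn_integral_flipped_interval[OF True] f_eq
        by (auto simp: ennreal_mult'[symmetric] indicator_def)
    qed (simp add: indicator_def)
  qed
  also have "\<dots> = (\<integral>\<^sup>+ r. ennreal ((r - min r ?d) / r\<^sup>2) * indicator {0<..1} r \<partial>lborel) + (\<integral>\<^sup>+ r. ennreal (?f r) \<partial>lborel)"
    by (rule nn_integral_add) measurable
  also have "(\<integral>\<^sup>+ r. ennreal (?f r) \<partial>lborel) = ennreal (ln_weight x + ln_weight y - ln_weight ?d)"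
    using f f_nonneg by (subst nn_integral_eq_integral) (auto simp: has_bochner_integral_iff lw)
  finally have K: "pos_kernel x y = (\<integral>\<^sup>+ r. ennreal ((r - min r ?d) / r\<^sup>2) * indicator {0<..1} r \<partial>lborel)
      + ennreal (ln_weight x + ln_weight y - ln_weight ?d)" .
  show "0 \<le> ln_weight x + ln_weight y - 1 - ln \<bar>x - y\<bar>" if "x \<noteq> y"
    using nn_integral_tent_le_1(2)[of ?d] that w2 by simp
  show ?th1
  proof (cases "x = y")
    case True
    have "(\<integral>\<^sup>+ r. ennreal ((r - min r ?d) / r\<^sup>2) * indicator {0<..1} r \<partial>lborel)
        = (\<integral>\<^sup>+ r. ennreal (r / r\<^sup>2) * indicator {0<..1} r \<partial>lborel)"
      using True by (intro nn_integral_cong) (auto simp: indicator_def)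
    with K True show ?thesis by (simp add: nn_integral_tent_0)
  next
    case False
    then have "?d > 0" by simp
    from K nn_integral_tent_le_1[OF this] w2 False show ?thesis
      by (simp flip: ennreal_plus)
  qed
qed

section \<open>Positivity of the energy\<close>

lemma borel_measurable_pos_kernel [measurable]:
  "(\<lambda>(x, y). pos_kernel x y) \<in> borel_measurable (borel \<Otimes>\<^sub>M borel)"
proof -
  interpret L: sigma_finite_measure "lborel \<Otimes>\<^sub>M lborel :: (real \<times> real) measure"
    by (simp add: lborel_prod sigma_finite_lborel)
  show ?thesis
    unfolding pos_kernel_def by measurable
qed

lemma borel_measurable_pos_kernel_2 [measurable]: "pos_kernel x \<in> borel_measurable borel"
  using measurable_compose_Pair1[OF _ borel_measurable_pos_kernel, of x] by simp

definition mutual_energy :: "real measure \<Rightarrow> real measure \<Rightarrow> ennreal" where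
  "mutual_energy \<nu> \<mu> = (\<integral>\<^sup>+ x. \<integral>\<^sup>+ y. pos_kernel x y \<partial>\<mu> \<partial>\<nu>)"

lemma borel_prob_measuresD:
  assumes "\<mu> \<in> borel_prob_measures"
  shows "prob_space \<mu>" "sets \<mu> = sets borel" "real_distribution \<mu>"
  using assms by (auto simp: borel_prob_measures_def real_distribution_def real_distribution_axioms_def)

text \<open>The kernel is nonnegative, so Tonelli applies without any moment condition; for fixed p
  the integral of the two indicators factorises.\<close>

lemma mutual_energy_eq:
  assumes "\<nu> \<in> borel_prob_measures" "\<mu> \<in> borel_prob_measures"
  shows "mutual_energy \<nu> \<mu> = (\<integral>\<^sup>+ p. interval_weight p *
           ennreal (measure \<nu> (flipped_interval p) * measure \<mu> (flipped_interval p)) \<partial>(lborel \<Otimes>\<^sub>M lborel))"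
proof -
  note [measurable_cong] = borel_prob_measuresD(2)[OF assms(1)] borel_prob_measuresD(2)[OF assms(2)]
  interpret M: real_distribution \<mu> by (rule borel_prob_measuresD(3)[OF assms(2)])
  interpret N: real_distribution \<nu> by (rule borel_prob_measuresD(3)[OF assms(1)])
  interpret L: sigma_finite_measure "lborel \<Otimes>\<^sub>M lborel :: (real \<times> real) measure"
    by (simp add: lborel_prod sigma_finite_lborel)
  interpret LM: pair_sigma_finite "lborel \<Otimes>\<^sub>M lborel :: (real \<times> real) measure" \<mu> ..
  interpret LN: pair_sigma_finite "lborel \<Otimes>\<^sub>M lborel :: (real \<times> real) measure" \<nu> ..
  let ?I = "\<lambda>p. indicator (flipped_interval p) :: real \<Rightarrow> ennreal"
  have int: "(\<integral>\<^sup>+ y. ?I p y \<partial>\<mu>) = emeasure \<mu> (flipped_interval p)"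
    "(\<integral>\<^sup>+ y. ?I p y \<partial>\<nu>) = emeasure \<nu> (flipped_interval p)" for p
    by (simp_all add: borel_prob_measuresD(2)[OF assms(1)] borel_prob_measuresD(2)[OF assms(2)])
  have "(\<integral>\<^sup>+ y. pos_kernel x y \<partial>\<mu>) = (\<integral>\<^sup>+ p. interval_weight p * ?I p x * emeasure \<mu> (flipped_interval p) \<partial>(lborel \<Otimes>\<^sub>M lborel))"
    for x
  proof -
    have "(\<integral>\<^sup>+ y. pos_kernel x y \<partial>\<mu>)
        = (\<integral>\<^sup>+ p. (\<integral>\<^sup>+ y. interval_weight p * (?I p x * ?I p y) \<partial>\<mu>) \<partial>(lborel \<Otimes>\<^sub>M lborel))"
      unfolding pos_kernel_def by (rule LM.Fubini') measurable
    also have "\<dots> = (\<integral>\<^sup>+ p. interval_weight p * ?I p x * (\<integral>\<^sup>+ y. ?I p y \<partial>\<mu>) \<partial>(lborel \<Otimes>\<^sub>M lborel))"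
      by (intro nn_integral_cong) (simp add: nn_integral_cmult mult.assoc)
    finally show ?thesis by (simp only: int)
  qed
  then have "mutual_energy \<nu> \<mu>
      = (\<integral>\<^sup>+ x. (\<integral>\<^sup>+ p. interval_weight p * ?I p x * (\<integral>\<^sup>+ y. ?I p y \<partial>\<mu>) \<partial>(lborel \<Otimes>\<^sub>M lborel)) \<partial>\<nu>)"
    unfolding mutual_energy_def by (simp only: int)
  also have "\<dots> = (\<integral>\<^sup>+ p. (\<integral>\<^sup>+ x. interval_weight p * ?I p x * (\<integral>\<^sup>+ y. ?I p y \<partial>\<mu>) \<partial>\<nu>) \<partial>(lborel \<Otimes>\<^sub>M lborel))"
    by (rule LN.Fubini') measurable
  also have "\<dots> = (\<integral>\<^sup>+ p. interval_weight p * (\<integral>\<^sup>+ y. ?I p y \<partial>\<mu>) * (\<integral>\<^sup>+ x. ?I p x \<partial>\<nu>) \<partial>(lborel \<Otimes>\<^sub>M lborel))"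
  proof (intro nn_integral_cong)
    fix p
    have "(\<integral>\<^sup>+ x. interval_weight p * ?I p x * (\<integral>\<^sup>+ y. ?I p y \<partial>\<mu>) \<partial>\<nu>)
        = (\<integral>\<^sup>+ x. (interval_weight p * (\<integral>\<^sup>+ y. ?I p y \<partial>\<mu>)) * ?I p x \<partial>\<nu>)"
      by (simp only: ac_simps)
    also have "\<dots> = (interval_weight p * (\<integral>\<^sup>+ y. ?I p y \<partial>\<mu>)) * (\<integral>\<^sup>+ x. ?I p x \<partial>\<nu>)"
      by (rule nn_integral_cmult) simp
    finally show "(\<integral>\<^sup>+ x. interval_weight p * ?I p x * (\<integral>\<^sup>+ y. ?I p y \<partial>\<mu>) \<partial>\<nu>) = \<dots>" .
  qed
  also have "\<dots> = (\<integral>\<^sup>+ p. interval_weight p *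
           ennreal (measure \<nu> (flipped_interval p) * measure \<mu> (flipped_interval p)) \<partial>(lborel \<Otimes>\<^sub>M lborel))"
    by (simp only: int M.emeasure_eq_measure N.emeasure_eq_measure)
       (simp add: ennreal_mult' ac_simps)
  finally show ?thesis .
qed

lemma borel_measurable_measure_flipped_interval [measurable]:
  assumes "\<mu> \<in> borel_prob_measures"
  shows "(\<lambda>p. measure \<mu> (flipped_interval p)) \<in> borel_measurable (borel \<Otimes>\<^sub>M borel)"
proof -
  note [measurable_cong] = borel_prob_measuresD(2)[OF assms]
  interpret M: real_distribution \<mu> by (rule borel_prob_measuresD(3)[OF assms])
  have "(\<lambda>p. \<integral>\<^sup>+ y. indicator (flipped_interval p) y \<partial>\<mu>) \<in> borel_measurable (borel \<Otimes>\<^sub>M borel)"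
    by measurable
  then have "(\<lambda>p. enn2real (\<integral>\<^sup>+ y. indicator (flipped_interval p) y \<partial>\<mu>)) \<in> borel_measurable (borel \<Otimes>\<^sub>M borel)"
    by measurable
  then show ?thesis
    by (simp add: measure_def borel_prob_measuresD(2)[OF assms])
qed

text \<open>The energy of the signed measure \<nu> - \<mu>. Defining it through squares rather than
  as a difference of energies keeps it meaningful when those energies are infinite.\<close>

definition energy_distance :: "real measure \<Rightarrow> real measure \<Rightarrow> ennreal" where
  "energy_distance \<nu> \<mu> = (\<integral>\<^sup>+ p. interval_weight p *
     ennreal ((measure \<nu> (flipped_interval p) - measure \<mu> (flipped_interval p))\<^sup>2) \<partial>(lborel \<Otimes>\<^sub>M lborel))"

text \<open>Integrates n^2 + m^2 = 2 n m + (n - m)^2 over p. With the mixed term on the right there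
  is no subtraction, so infinite values are allowed.\<close>

lemma mutual_energy_polarization:
  assumes \<nu>: "\<nu> \<in> borel_prob_measures" and \<mu>: "\<mu> \<in> borel_prob_measures"
  shows "mutual_energy \<nu> \<nu> + mutual_energy \<mu> \<mu> = 2 * mutual_energy \<nu> \<mu> + energy_distance \<nu> \<mu>"
proof -
  note [measurable] = borel_measurable_measure_flipped_interval[OF \<nu>] borel_measurable_measure_flipped_interval[OF \<mu>]
  let ?n = "\<lambda>p. measure \<nu> (flipped_interval p)" and ?m = "\<lambda>p. measure \<mu> (flipped_interval p)"
  let ?L = "lborel \<Otimes>\<^sub>M lborel :: (real \<times> real) measure"
  have "mutual_energy \<nu> \<nu> + mutual_energy \<mu> \<mu>
      = (\<integral>\<^sup>+ p. interval_weight p * ennreal (?n p * ?n p) + interval_weight p * ennreal (?m p * ?m p) \<partial>?L)"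
    unfolding mutual_energy_eq[OF \<nu> \<nu>] mutual_energy_eq[OF \<mu> \<mu>]
    by (rule nn_integral_add[symmetric]) measurable
  also have "\<dots> = (\<integral>\<^sup>+ p. 2 * (interval_weight p * ennreal (?n p * ?m p)) + interval_weight p * ennreal ((?n p - ?m p)\<^sup>2) \<partial>?L)"
  proof (intro nn_integral_cong)
    fix p
    have "ennreal (?n p * ?n p) + ennreal (?m p * ?m p) = ennreal (2 * (?n p * ?m p)) + ennreal ((?n p - ?m p)\<^sup>2)"
    proof -
      have "?n p * ?n p + ?m p * ?m p = 2 * (?n p * ?m p) + (?n p - ?m p)\<^sup>2"
        by (simp add: power2_eq_square algebra_simps)
      then have "ennreal (?n p * ?n p + ?m p * ?m p) = ennreal (2 * (?n p * ?m p) + (?n p - ?m p)\<^sup>2)"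
        by (simp only:)
      then show ?thesis by (subst (asm) (1 2) ennreal_plus) simp_all
    qed
    then show "interval_weight p * ennreal (?n p * ?n p) + interval_weight p * ennreal (?m p * ?m p)
       = 2 * (interval_weight p * ennreal (?n p * ?m p)) + interval_weight p * ennreal ((?n p - ?m p)\<^sup>2)"
      by (simp add: distrib_left[symmetric] ennreal_mult' mult.left_commute)
  qed
  also have "\<dots> = 2 * mutual_energy \<nu> \<mu> + energy_distance \<nu> \<mu>"
    unfolding mutual_energy_eq[OF \<nu> \<mu>] energy_distance_def
    by (subst nn_integral_add) (auto simp: nn_integral_cmult)
  finally show ?thesis .
qed

text \<open>By right continuity the period \<open>r\<close> holds everywhere, so \<open>G u = G (u - n r) \<longrightarrow> 0\<close>.\<close>

lemma AE_shift_invariant_eq_0: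
  fixes G :: "real \<Rightarrow> real"
  assumes cont: "\<And>u. continuous (at_right u) G" and lim: "(G \<longlongrightarrow> 0) at_bot"
    and r: "r > 0" and AE: "AE u in lborel. G u = G (u - r)"
  shows "G u = 0"
proof -
  have shift: "G u = G (u - r)" for u
  proof (rule ccontr)
    assume "G u \<noteq> G (u - r)"
    have "((\<lambda>v. G (v - r)) \<longlongrightarrow> G (u - r)) (at_right u)"
      using cont[of "u - r"] filtermap_at_right_shift[of r u]
      by (simp add: continuous_within filterlim_def filtermap_filtermap[symmetric, of G "\<lambda>v. v - r"])
    then have "((\<lambda>v. G v - G (v - r)) \<longlongrightarrow> G u - G (u - r)) (at_right u)"
      using cont[of u] unfolding continuous_within by (intro tendsto_intros)
    then have "\<forall>\<^sub>F v in at_right u. G v - G (v - r) \<noteq> 0"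
      using \<open>G u \<noteq> _\<close> by (intro tendsto_imp_eventually_ne) auto
    then obtain b where b: "b > u" "\<And>v. u < v \<Longrightarrow> v < b \<Longrightarrow> G v - G (v - r) \<noteq> 0"
      unfolding eventually_at_right_field by blast
    from AE have "AE v in lborel. v \<notin> {u<..<b}"
      by eventually_elim (use b in auto)
    then have "emeasure lborel {u<..<b} = 0"
      by (subst (asm) AE_iff_measurable[of "{u<..<b}"]) auto
    with b show False by simp
  qed
  have iter: "G u = G (u - real n * r)" for n
  proof (induction n)
    case (Suc n)
    then show ?case using shift[of "u - real n * r"] by (simp add: algebra_simps)
  qed simp
  have "filterlim (\<lambda>n. u - real n * r) at_bot sequentially"
    using r by real_asymp
  from filterlim_compose[OF lim this] have "(\<lambda>n. G u) \<longlonglongrightarrow> 0"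
    by (simp add: iter[symmetric])
  then show ?thesis by (simp add: LIMSEQ_const_iff)
qed

text \<open>A single length r suffices: if almost all intervals (u - r, u] have equal mass under
  both measures, then the difference of the distribution functions has period r almost everywhere,
  and it vanishes at minus infinity.\<close>

lemma energy_distance_eq_0_imp_eq:
  assumes \<nu>: "\<nu> \<in> borel_prob_measures" and \<mu>: "\<mu> \<in> borel_prob_measures"
    and 0: "energy_distance \<nu> \<mu> = 0"
  shows "\<nu> = \<mu>"
proof -
  interpret M: real_distribution \<mu> by (rule borel_prob_measuresD(3)[OF \<mu>])
  interpret N: real_distribution \<nu> by (rule borel_prob_measuresD(3)[OF \<nu>])
  note [measurable] = borel_measurable_measure_flipped_interval[OF \<nu>] borel_measurable_measure_flipped_interval[OF \<mu>]
  have "AE p in lborel \<Otimes>\<^sub>M lborel. interval_weight p *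
     ennreal ((measure \<nu> (flipped_interval p) - measure \<mu> (flipped_interval p))\<^sup>2) = 0"
    using 0 unfolding energy_distance_def by (subst (asm) nn_integral_0_iff_AE) auto
  then have "AE r in lborel. AE u in lborel. interval_weight (r, u) *
     ennreal ((measure \<nu> (flipped_interval (r, u)) - measure \<mu> (flipped_interval (r, u)))\<^sup>2) = 0"
    by (rule lborel_pair.AE_pair)
  \<comment> \<open>If no positive r were good, then all r in (0, 1) would be exceptional, although
    this interval is not a null set.\<close>
  then have "\<exists>r\<in>{0<..}. AE u in lborel. interval_weight (r, u) *
     ennreal ((measure \<nu> (flipped_interval (r, u)) - measure \<mu> (flipped_interval (r, u)))\<^sup>2) = 0"
  proof (rule contrapos_pp)
    assume neg: "\<not> (\<exists>r\<in>{0<..}. AE u in lborel. interval_weight (r, u) *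
     ennreal ((measure \<nu> (flipped_interval (r, u)) - measure \<mu> (flipped_interval (r, u)))\<^sup>2) = 0)"
    show "\<not> (AE r in lborel. AE u in lborel. interval_weight (r, u) *
     ennreal ((measure \<nu> (flipped_interval (r, u)) - measure \<mu> (flipped_interval (r, u)))\<^sup>2) = 0)"
    proof
      assume "AE r in lborel. AE u in lborel. interval_weight (r, u) *
     ennreal ((measure \<nu> (flipped_interval (r, u)) - measure \<mu> (flipped_interval (r, u)))\<^sup>2) = 0"
      then have "AE r in lborel. r \<notin> {0<..<1::real}"
        by eventually_elim (use neg in auto)
      then have "emeasure lborel {0<..<1::real} = 0"
        by (subst (asm) AE_iff_measurable[of "{0<..<1}"]) auto
      then show False by simp
    qed
  qed
  then obtain r where r: "r > 0" and ae: "AE u in lborel. interval_weight (r, u) *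
     ennreal ((measure \<nu> (flipped_interval (r, u)) - measure \<mu> (flipped_interval (r, u)))\<^sup>2) = 0"
    by auto
  define G where "G = (\<lambda>u. cdf \<nu> u - cdf \<mu> u)"
  have "AE u in lborel. G u = G (u - r)"
    using ae
  proof eventually_elim
    case (elim u)
    then have "measure \<nu> (flipped_interval (r, u)) = measure \<mu> (flipped_interval (r, u))"
      using r by (simp add: interval_weight_def)
    \<comment> \<open>Both measures have total mass 1, so equal masses of the complements give equal
      masses of the intervals.\<close>
    moreover have "flipped_interval (r, u) = {u - r<..u} \<or> flipped_interval (r, u) = space \<mu> - {u - r<..u}"
      by (auto simp: flipped_interval_def)
    ultimately have "measure \<nu> {u - r<..u} = measure \<mu> {u - r<..u}"
      using M.prob_compl[of "{u - r<..u}"] N.prob_compl[of "{u - r<..u}"] by auto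
    then show ?case
      using M.cdf_diff_eq[of "u - r" u] N.cdf_diff_eq[of "u - r" u] r by (simp add: G_def)
  qed
  moreover have "continuous (at_right u) G" for u
    unfolding G_def by (intro continuous_diff M.cdf_is_right_cont N.cdf_is_right_cont)
  moreover have "(G \<longlongrightarrow> 0) at_bot"
    unfolding G_def using tendsto_diff[OF N.cdf_lim_at_bot M.cdf_lim_at_bot] by simp
  ultimately have "G u = 0" for u
    using r by (rule_tac AE_shift_invariant_eq_0)
  then have "cdf \<nu> = cdf \<mu>" by (auto simp: G_def)
  then show ?thesis
    by (intro cdf_unique) (unfold_locales)
qed

section \<open>The weighted energy and the equilibrium condition\<close>

text \<open>\<open>K\<close> may have infinite integral, so integrals cannot simply be subtracted.
  The negative part of \<open>f\<close> is dominated by that of \<open>q\<close> and has finite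
  integral; this keeps the difference defining \<open>ereal_integral\<close> meaningful.\<close>

lemma ereal_integral_enn2ereal_add:
  fixes K :: "'a \<Rightarrow> ennreal" and q :: "'a \<Rightarrow> real"
  assumes K [measurable]: "K \<in> borel_measurable N" and q: "integrable N q"
    and f: "\<And>x. f x = enn2ereal (K x) + ereal (q x)"
  shows "pos_integral N (\<lambda>x. - f x) < \<infinity>"
    and "ereal_integral N f = enn2ereal (\<integral>\<^sup>+ x. K x \<partial>N) + ereal (\<integral>x. q x \<partial>N)"
proof -
  have [measurable]: "q \<in> borel_measurable N" using q by simp
  have [measurable]: "f \<in> borel_measurable N"
  proof -
    have "(\<lambda>x. enn2ereal (K x) + ereal (q x)) \<in> borel_measurable N" by measurable
    then show ?thesis by (simp add: f[abs_def])
  qed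
  \<comment> \<open>This is f = K + q written with positive and negative parts and rearranged so
    that no subtraction occurs; it remains true where \<open>K\<close> is infinite.\<close>
  have 1: "e2ennreal (f x) + ennreal (- q x) = e2ennreal (- f x) + K x + ennreal (q x)" for x
  proof (cases "K x")
    case (real k)
    have "max 0 (k + q x) + max 0 (- q x) = max 0 (- (k + q x)) + k + max 0 (q x)"
      using real by (auto simp: max_def)
    then have "ennreal (max 0 (k + q x) + max 0 (- q x)) = ennreal (max 0 (- (k + q x)) + k + max 0 (q x))"
      by simp
    then have "ennreal (k + q x) + ennreal (- q x) = ennreal (- (k + q x)) + ennreal k + ennreal (q x)"
      using real by (simp add: ennreal_plus ennreal_max_0)
    moreover have "f x = ereal (k + q x)" using real by (simp add: f enn2ereal_ennreal)
    ultimately show ?thesis using real by simp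
  next
    case top
    then show ?thesis by (simp add: f)
  qed
  let ?P = "\<integral>\<^sup>+ x. e2ennreal (f x) \<partial>N" and ?N = "\<integral>\<^sup>+ x. e2ennreal (- f x) \<partial>N"
  let ?a = "\<integral>\<^sup>+ x. ennreal (q x) \<partial>N" and ?b = "\<integral>\<^sup>+ x. ennreal (- q x) \<partial>N"
  have eq: "?P + ?b = ?N + (\<integral>\<^sup>+ x. K x \<partial>N) + ?a"
  proof -
    have "?P + ?b = (\<integral>\<^sup>+ x. e2ennreal (f x) + ennreal (- q x) \<partial>N)"
      by (rule nn_integral_add[symmetric]) measurable
    also have "\<dots> = (\<integral>\<^sup>+ x. e2ennreal (- f x) + K x + ennreal (q x) \<partial>N)"
      by (simp only: 1)
    also have "\<dots> = ?N + (\<integral>\<^sup>+ x. K x \<partial>N) + ?a"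
      by (simp add: nn_integral_add)
    finally show ?thesis .
  qed
  have ab: "?a < \<infinity>" "?b < \<infinity>" "(\<integral>x. q x \<partial>N) = enn2real ?a - enn2real ?b"
    using q real_lebesgue_integral_def[OF q] by (auto simp: real_integrable_def less_top)
  have "?N \<le> ?b"
  proof (rule nn_integral_mono)
    fix x
    have "- f x \<le> ereal (- q x)"
      by (cases "K x") (auto simp: f enn2ereal_ennreal)
    then show "e2ennreal (- f x) \<le> ennreal (- q x)"
      using e2ennreal_mono by fastforce
  qed
  with ab have N: "?N < \<infinity>" by (simp add: le_less_trans)
  then show "pos_integral N (\<lambda>x. - f x) < \<infinity>" by (simp add: pos_integral_def)
  obtain a b n where abn: "?a = ennreal a" "?b = ennreal b" "?N = ennreal n" "a \<ge> 0" "b \<ge> 0" "n \<ge> 0"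
    using ab N by (cases ?a; cases ?b; cases ?N) auto
  show "ereal_integral N f = enn2ereal (\<integral>\<^sup>+ x. K x \<partial>N) + ereal (\<integral>x. q x \<partial>N)"
  proof (cases "\<integral>\<^sup>+ x. K x \<partial>N")
    case (real k)
    with eq abn have "?P + ennreal b = ennreal (n + k + a)" by (simp flip: ennreal_plus)
    then obtain p where p: "?P = ennreal p" "p \<ge> 0" by (cases ?P) auto
    with \<open>?P + ennreal b = _\<close> abn real have "p + b = n + k + a"
      by (simp flip: ennreal_plus)
    then have "p - n = k + (a - b)" by simp
    then show ?thesis
      using abn real p ab by (simp add: ereal_integral_def pos_integral_def enn2ereal_ennreal)
  next
    case top
    with eq abn have "?P + ennreal b = top" by simp
    then have "?P = top" by (simp add: ennreal_add_eq_top)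
    with top abn show ?thesis
      by (simp add: ereal_integral_def pos_integral_def enn2ereal_ennreal)
  qed
qed

lemma (in prob_space) distr_pair_snd:
  assumes "prob_space N"
  shows "distr (M \<Otimes>\<^sub>M N) N snd = N"
proof -
  interpret N: prob_space N by fact
  interpret P: pair_sigma_finite M N ..
  have "distr (M \<Otimes>\<^sub>M N) N snd = distr (distr (N \<Otimes>\<^sub>M M) (M \<Otimes>\<^sub>M N) (\<lambda>(x, y). (y, x))) N snd"
    by (simp flip: P.distr_pair_swap)
  also have "\<dots> = distr (N \<Otimes>\<^sub>M M) N fst"
    by (subst distr_distr) (auto simp: comp_def case_prod_unfold)
  finally show ?thesis by (simp add: distr_pair_fst)
qed

lemma (in prob_space) integral_pair_add:
  fixes h :: "'a \<Rightarrow> real"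
  assumes h: "integrable M h"
  shows "integrable (M \<Otimes>\<^sub>M M) (\<lambda>(x, y). h x + h y)"
    and "(\<integral>p. (case p of (x, y) \<Rightarrow> h x + h y) \<partial>(M \<Otimes>\<^sub>M M)) = 2 * (\<integral>x. h x \<partial>M)"
proof -
  have 1: "has_bochner_integral (M \<Otimes>\<^sub>M M) (\<lambda>p. h (fst p)) (\<integral>x. h x \<partial>M)"
    using integrable_distr_eq[of fst "M \<Otimes>\<^sub>M M" M h] integral_distr[of fst "M \<Otimes>\<^sub>M M" M h] h
      distr_pair_fst[of M] by (simp add: has_bochner_integral_iff)
  have 2: "has_bochner_integral (M \<Otimes>\<^sub>M M) (\<lambda>p. h (snd p)) (\<integral>x. h x \<partial>M)"
    using integrable_distr_eq[of snd "M \<Otimes>\<^sub>M M" M h] integral_distr[of snd "M \<Otimes>\<^sub>M M" M h] h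
      distr_pair_snd[OF prob_space_axioms] by (simp add: has_bochner_integral_iff)
  from has_bochner_integral_add[OF 1 2]
  show "integrable (M \<Otimes>\<^sub>M M) (\<lambda>(x, y). h x + h y)"
    "(\<integral>p. (case p of (x, y) \<Rightarrow> h x + h y) \<partial>(M \<Otimes>\<^sub>M M)) = 2 * (\<integral>x. h x \<partial>M)"
    by (simp_all add: has_bochner_integral_iff case_prod_unfold)
qed

section \<open>Reduction of the weighted energy to the nonnegative kernel\<close>

lemma log_kernel_eq:
  "log_kernel x y = enn2ereal (pos_kernel x y) + ereal (1 - (ln_weight x + ln_weight y))"
proof (cases "x = y")
  case False
  then show ?thesis
    using ln_weight_minus_ln_nonneg[OF False]
    by (simp add: log_kernel_def pos_kernel_eq enn2ereal_ennreal ln_div)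
qed (simp add: log_kernel_def pos_kernel_eq)

text \<open>Serves to pass from the kernel to moments: if the positive part of
  \<open>ln \<bar>x - y\<bar>\<close> is integrable in y for a single x, then
  \<open>ln_weight\<close> is integrable.\<close>

lemma ln_weight_le: "ln_weight y \<le> max 0 (ln \<bar>x - y\<bar>) + (1 + \<bar>x\<bar>)"
proof -
  have "max 1 \<bar>y\<bar> \<le> max 1 \<bar>x - y\<bar> + \<bar>x\<bar>" by (auto simp: max_def)
  \<comment> \<open>A sum m + n with m \<ge> 1 and n \<ge> 0 is at most m (1 + n); the logarithm of
    this product splits.\<close>
  also have "\<dots> \<le> max 1 \<bar>x - y\<bar> * (1 + \<bar>x\<bar>)"
    by (simp add: distrib_left) (metis abs_ge_zero max.cobounded1 mult_le_cancel_right1 not_less)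
  finally have "ln (max 1 \<bar>y\<bar>) \<le> ln (max 1 \<bar>x - y\<bar> * (1 + \<bar>x\<bar>))"
    by (subst ln_le_cancel_iff) (auto intro!: mult_pos_pos)
  also have "\<dots> = ln (max 1 \<bar>x - y\<bar>) + ln (1 + \<bar>x\<bar>)" by (rule ln_mult_pos) auto
  also have "ln (1 + \<bar>x\<bar>) \<le> \<bar>x\<bar>" by (rule ln_add_one_self_le_self) simp
  also have "ln (max 1 \<bar>x - y\<bar>) \<le> max 0 (ln \<bar>x - y\<bar>)" by (simp add: max_def)
  moreover have "\<bar>y\<bar> / max 1 \<bar>y\<bar> \<le> 1" by (simp add: max_def)
  ultimately show ?thesis unfolding ln_weight_def by simp
qed

text \<open>Both branches of \<open>weighted_energy\<close> lead to the integral of the combined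
  kernel. If \<open>ln_weight\<close> is integrable, the logarithmic energy plus twice the finite
  field term gives the same value. Otherwise the field term is \<infinity>, while the logarithmic
  energy is undefined or minus infinity, so the definition selects the combined kernel.\<close>

lemma weighted_energy_eq:
  fixes V :: "real \<Rightarrow> real"
  assumes \<nu>: "\<nu> \<in> borel_prob_measures" and V [measurable]: "V \<in> borel_measurable borel"
    and bound: "\<And>x. \<bar>V x - ln_weight x\<bar> \<le> B"
  shows "weighted_energy V \<nu> =
    enn2ereal (mutual_energy \<nu> \<nu>) + ereal (1 + 2 * (\<integral>x. V x - ln_weight x \<partial>\<nu>))"
proof -
  note [measurable_cong, simp] = borel_prob_measuresD(2)[OF \<nu>]
  interpret real_distribution \<nu> by (rule borel_prob_measuresD(3)[OF \<nu>])
  interpret P: pair_prob_space \<nu> \<nu> ..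
  have emeasure_UNIV: "emeasure \<nu> UNIV = 1" using emeasure_space_1 by simp
  define Q where "Q = (\<lambda>x. V x - ln_weight x)"
  have [measurable]: "Q \<in> borel_measurable borel" unfolding Q_def by measurable
  have Q: "integrable \<nu> Q"
    by (rule integrable_const_bound[of _ B]) (use bound in \<open>auto simp: Q_def\<close>)
  let ?N = "\<nu> \<Otimes>\<^sub>M \<nu>"
  let ?k = "\<lambda>(x, y). log_kernel x y"
  let ?K = "\<lambda>(x, y). pos_kernel x y"
  let ?c = "\<lambda>(x, y). log_kernel x y + ereal (V x) + ereal (V y)"
  have M: "(\<integral>\<^sup>+ p. ?K p \<partial>?N) = mutual_energy \<nu> \<nu>"
    unfolding mutual_energy_def by (subst nn_integral_fst[symmetric]) auto
  have [measurable]: "?K \<in> borel_measurable ?N" by measurable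
  have combined: "ereal_integral ?N ?c = enn2ereal (mutual_energy \<nu> \<nu>) + ereal (1 + 2 * (\<integral>x. Q x \<partial>\<nu>))"
  proof -
    have "?c p = enn2ereal (?K p) + ereal (1 + (case p of (x, y) \<Rightarrow> Q x + Q y))" for p
      by (cases p; cases "pos_kernel (fst p) (snd p)")
         (auto simp: log_kernel_eq Q_def enn2ereal_ennreal)
    from ereal_integral_enn2ereal_add(2)[where N = ?N, OF _ _ this] integral_pair_add[OF Q]
    show ?thesis
      by (simp add: M P.prob_space)
  qed
  show ?thesis
  proof (cases "integrable \<nu> ln_weight")
    case True
    have V_int: "integrable \<nu> V"
      using Bochner_Integration.integrable_add[OF Q True] by (simp add: Q_def)
    have L: "ereal_integral ?N ?k = enn2ereal (mutual_energy \<nu> \<nu>) + ereal (1 - 2 * (\<integral>x. ln_weight x \<partial>\<nu>))"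
    proof -
      have "?k p = enn2ereal (?K p) + ereal (1 - (case p of (x, y) \<Rightarrow> ln_weight x + ln_weight y))" for p
        by (cases p) (auto simp: log_kernel_eq)
      from ereal_integral_enn2ereal_add(2)[where N = ?N, OF _ _ this] integral_pair_add[OF True]
      show ?thesis
        by (simp add: M P.prob_space)
    qed
    have W: "ereal_integral \<nu> (\<lambda>x. ereal (V x)) = ereal (\<integral>x. V x \<partial>\<nu>)"
      using ereal_integral_enn2ereal_add(2)[where N = \<nu> and K = "\<lambda>_. 0" and q = V and f = "\<lambda>x. ereal (V x)"] V_int
      by (simp add: zero_ennreal.rep_eq)
    have "(\<integral>x. V x \<partial>\<nu>) = (\<integral>x. Q x \<partial>\<nu>) + (\<integral>x. ln_weight x \<partial>\<nu>)"
      using Bochner_Integration.integral_add[OF Q True] by (simp add: Q_def)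
    then have "ereal_integral ?N ?k + 2 * ereal_integral \<nu> (\<lambda>x. ereal (V x))
        = enn2ereal (mutual_energy \<nu> \<nu>) + ereal (1 + 2 * (\<integral>x. Q x \<partial>\<nu>))"
      unfolding L W by (cases "mutual_energy \<nu> \<nu>") (auto simp: enn2ereal_ennreal)
    with combined show ?thesis
      unfolding weighted_energy_def Let_def by (simp add: Q_def)
  next
    case False
    have inf: "(\<integral>\<^sup>+ y. ennreal (ln_weight y) \<partial>\<nu>) = \<infinity>"
    proof (rule ccontr)
      assume "(\<integral>\<^sup>+ y. ennreal (ln_weight y) \<partial>\<nu>) \<noteq> \<infinity>"
      then have "(\<integral>\<^sup>+ y. ennreal (ln_weight y) \<partial>\<nu>) < \<infinity>"
        by (simp add: less_top)
      then have "integrable \<nu> ln_weight"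
        by (intro integrableI_nonneg) (auto simp: ln_weight_nonneg)
      with False show False by simp
    qed
    have W_pos: "pos_integral \<nu> (\<lambda>x. ereal (V x)) = \<infinity>"
    proof (rule ccontr)
      assume *: "pos_integral \<nu> (\<lambda>x. ereal (V x)) \<noteq> \<infinity>"
      have "(\<integral>\<^sup>+ y. ennreal (ln_weight y) \<partial>\<nu>) \<le> (\<integral>\<^sup>+ y. ennreal (V y) + ennreal B \<partial>\<nu>)"
      proof (rule nn_integral_mono)
        fix y
        have "ln_weight y \<le> max 0 (V y) + B" "0 \<le> B" using bound[of y] by auto
        then have "ennreal (ln_weight y) \<le> ennreal (max 0 (V y) + B)"
          by (intro ennreal_leI)
        also have "\<dots> = ennreal (max 0 (V y)) + ennreal B"
          using \<open>0 \<le> B\<close> by (intro ennreal_plus) auto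
        finally show "ennreal (ln_weight y) \<le> ennreal (V y) + ennreal B"
          by (simp add: ennreal_max_0)
      qed
      also have "\<dots> < \<infinity>" using * by (simp add: nn_integral_add pos_integral_def emeasure_UNIV less_top)
      finally show False using inf by simp
    qed
    have W_neg: "pos_integral \<nu> (\<lambda>x. - ereal (V x)) < \<infinity>"
    proof -
      have "pos_integral \<nu> (\<lambda>x. - ereal (V x)) \<le> (\<integral>\<^sup>+ y. ennreal B \<partial>\<nu>)"
        unfolding pos_integral_def
      proof (rule nn_integral_mono)
        fix y
        have "- V y \<le> B" using bound[of y] ln_weight_nonneg[of y] by auto
        then show "e2ennreal (- ereal (V y)) \<le> ennreal B" by (simp add: ennreal_leI)
      qed
      also have "\<dots> < \<infinity>" by (simp add: emeasure_UNIV)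
      finally show ?thesis .
    qed
    have W: "ereal_integral \<nu> (\<lambda>x. ereal (V x)) = \<infinity>"
      using W_pos W_neg unfolding ereal_integral_def
      by (cases "pos_integral \<nu> (\<lambda>x. - ereal (V x))") (auto simp: enn2ereal_ennreal)
    \<comment> \<open>If the positive part of \<open>ln \<bar>x - y\<bar>\<close> had a finite
      double integral, its integral in y would be finite for some x, and \<open>ln_weight_le\<close>
      would make \<open>ln_weight\<close> integrable.\<close>
    have L_neg: "pos_integral ?N (\<lambda>p. - ?k p) = \<infinity>"
    proof (rule ccontr)
      assume "pos_integral ?N (\<lambda>p. - ?k p) \<noteq> \<infinity>"
      moreover have k: "e2ennreal (- log_kernel x y) = ennreal (ln \<bar>x - y\<bar>)" for x y
        by (auto simp: log_kernel_def ln_div e2ennreal_neg)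
      have "(\<lambda>p. e2ennreal (- ?k p)) = (\<lambda>p. ennreal (ln \<bar>fst p - snd p\<bar>))"
        by (auto simp: k case_prod_beta)
      ultimately have "(\<integral>\<^sup>+ p. ennreal (ln \<bar>fst p - snd p\<bar>) \<partial>?N) \<noteq> \<infinity>"
        by (simp add: pos_integral_def)
      then have "(\<integral>\<^sup>+ x. \<integral>\<^sup>+ y. ennreal (ln \<bar>x - y\<bar>) \<partial>\<nu> \<partial>\<nu>) \<noteq> \<infinity>"
        by (subst (asm) nn_integral_fst[symmetric]) auto
      then have "AE x in \<nu>. (\<integral>\<^sup>+ y. ennreal (ln \<bar>x - y\<bar>) \<partial>\<nu>) \<noteq> \<infinity>"
        by (intro nn_integral_PInf_AE) auto
      then have "\<exists>x. (\<integral>\<^sup>+ y. ennreal (ln \<bar>x - y\<bar>) \<partial>\<nu>) \<noteq> \<infinity>"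
        using AE_False by (metis (mono_tags, lifting) eventually_mono)
      then obtain x where x: "(\<integral>\<^sup>+ y. ennreal (ln \<bar>x - y\<bar>) \<partial>\<nu>) \<noteq> \<infinity>" by blast
      have "(\<integral>\<^sup>+ y. ennreal (ln_weight y) \<partial>\<nu>) \<le> (\<integral>\<^sup>+ y. ennreal (ln \<bar>x - y\<bar>) + ennreal (1 + \<bar>x\<bar>) \<partial>\<nu>)"
      proof (rule nn_integral_mono)
        fix y
        have "ennreal (ln_weight y) \<le> ennreal (max 0 (ln \<bar>x - y\<bar>) + (1 + \<bar>x\<bar>))"
          by (intro ennreal_leI ln_weight_le)
        also have "\<dots> = ennreal (max 0 (ln \<bar>x - y\<bar>)) + ennreal (1 + \<bar>x\<bar>)"
          by (intro ennreal_plus) auto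
        finally show "ennreal (ln_weight y) \<le> ennreal (ln \<bar>x - y\<bar>) + ennreal (1 + \<bar>x\<bar>)"
          by (simp add: ennreal_max_0)
      qed
      also have "\<dots> < \<infinity>" using x by (simp add: nn_integral_add emeasure_UNIV less_top)
      finally show False using inf by simp
    qed
    \<comment> \<open>Being defined then forces a finite positive part, and together with
      \<open>W\<close> this is the excluded form \<infinity> - \<infinity>.\<close>
    have "ereal_integral ?N ?k = - \<infinity>" if "integral_defined ?N ?k"
      using that L_neg unfolding integral_defined_def ereal_integral_def
      by (cases "pos_integral ?N ?k") (auto simp: enn2ereal_ennreal)
    with combined W show ?thesis
      unfolding weighted_energy_def Let_def by (auto simp: Q_def)
  qed
qed

text \<open>Integrating \<open>ge\<close> against \<nu> bounds the mutual energy of \<nu> and \<mu>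
  from below, and integrating \<open>eq\<close> against \<mu> computes the energy of \<mu>.
  Polarization combines the two into: the weighted energy of \<nu> is at least that of \<mu> plus
  \<open>energy_distance \<nu> \<mu>\<close>. This gives minimality and uniqueness at once.\<close>

lemma equilibrium_measureI:
  fixes V P :: "real \<Rightarrow> real"
  assumes \<mu>: "\<mu> \<in> borel_prob_measures" and V [measurable]: "V \<in> borel_measurable borel"
    and bound: "\<And>x. \<bar>V x - ln_weight x\<bar> \<le> B"
    and P: "\<And>x. (\<integral>\<^sup>+ y. pos_kernel x y \<partial>\<mu>) = ennreal (P x)" "\<And>x. 0 \<le> P x"
    and ge: "\<And>x. l \<le> P x + (V x - ln_weight x)"
    and eq: "AE x in \<mu>. P x + (V x - ln_weight x) = l"
  shows "is_equilibrium_measure V \<mu>"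
proof -
  define Q where "Q = (\<lambda>x. V x - ln_weight x)"
  have [measurable]: "Q \<in> borel_measurable borel" unfolding Q_def by measurable
  have Q: "integrable \<nu> Q" if \<nu>: "\<nu> \<in> borel_prob_measures" for \<nu>
  proof -
    interpret real_distribution \<nu> by (rule borel_prob_measuresD(3)[OF \<nu>])
    show ?thesis
      by (rule integrable_const_bound[of _ B]) (use bound in \<open>auto simp: Q_def\<close>)
  qed
  interpret M: real_distribution \<mu> by (rule borel_prob_measuresD(3)[OF \<mu>])
  define q where "q = (\<integral>x. Q x \<partial>\<mu>)"
  have lQ: "AE x in \<mu>. P x = l - Q x" using eq by eventually_elim (simp add: Q_def)
  have "mutual_energy \<mu> \<mu> = (\<integral>\<^sup>+ x. ennreal (l - Q x) \<partial>\<mu>)"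
    unfolding mutual_energy_def P(1) using lQ by (intro nn_integral_cong_AE) auto
  also have "\<dots> = ennreal (\<integral>x. l - Q x \<partial>\<mu>)"
  proof (rule nn_integral_eq_integral)
    show "AE x in \<mu>. 0 \<le> l - Q x" using lQ by eventually_elim (metis P(2))
  qed (use Q[OF \<mu>] in simp)
  also have "(\<integral>x. l - Q x \<partial>\<mu>) = l - q"
    using Q[OF \<mu>] by (simp add: q_def M.prob_space[simplified])
  finally have E\<mu>: "mutual_energy \<mu> \<mu> = ennreal (l - q)" .
  have "AE x in \<mu>. 0 \<le> l - Q x" using lQ by eventually_elim (metis P(2))
  then have "0 \<le> (\<integral>x. l - Q x \<partial>\<mu>)" by (rule integral_nonneg_AE)
  then have lq: "0 \<le> l - q" using Q[OF \<mu>] by (simp add: q_def M.prob_space[simplified])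
  have I\<mu>: "weighted_energy V \<mu> = ereal (l + q + 1)"
    using weighted_energy_eq[OF \<mu> V bound] E\<mu> lq by (simp add: Q_def[symmetric] q_def[symmetric] enn2ereal_ennreal)
  have key: "weighted_energy V \<mu> + enn2ereal (energy_distance \<nu> \<mu>) \<le> weighted_energy V \<nu>"
    if \<nu>: "\<nu> \<in> borel_prob_measures" for \<nu>
  proof -
    interpret N: real_distribution \<nu> by (rule borel_prob_measuresD(3)[OF \<nu>])
    define s where "s = (\<integral>x. Q x \<partial>\<nu>)"
    have I\<nu>: "weighted_energy V \<nu> = enn2ereal (mutual_energy \<nu> \<nu>) + ereal (1 + 2 * s)"
      using weighted_energy_eq[OF \<nu> V bound] by (simp add: Q_def[symmetric] s_def[symmetric])
    have "l - s = (\<integral>x. l - Q x \<partial>\<nu>)"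
      using Q[OF \<nu>] by (simp add: s_def N.prob_space[simplified])
    \<comment> \<open>\<open>l - Q x\<close> may be negative at some points. Its positive part is
      still at most \<open>P x\<close>, because \<open>P x\<close> is nonnegative, and it can be
      integrated in \<open>ennreal\<close>.\<close>
    also have "\<dots> \<le> (\<integral>x. max 0 (l - Q x) \<partial>\<nu>)"
      using Q[OF \<nu>] by (intro integral_mono) auto
    finally have "ennreal (l - s) \<le> ennreal (\<integral>x. max 0 (l - Q x) \<partial>\<nu>)"
      by (rule ennreal_leI)
    also have "\<dots> = (\<integral>\<^sup>+ x. ennreal (max 0 (l - Q x)) \<partial>\<nu>)"
      using Q[OF \<nu>] by (intro nn_integral_eq_integral[symmetric]) auto
    also have "\<dots> \<le> mutual_energy \<nu> \<mu>"
      unfolding mutual_energy_def P(1) using ge P(2)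
      by (intro nn_integral_mono ennreal_leI) (simp add: Q_def algebra_simps)
    finally have m: "ennreal (l - s) \<le> mutual_energy \<nu> \<mu>" .
    note pol = mutual_energy_polarization[OF \<nu> \<mu>]
    show ?thesis
    proof (cases "mutual_energy \<nu> \<nu>")
      \<comment> \<open>A measure of infinite self-energy satisfies the inequality trivially; in the
        other case all terms of the polarization identity are finite.\<close>
      case top
      then show ?thesis by (simp add: I\<nu>)
    next
      case (real e)
      with pol E\<mu> lq have sum: "2 * mutual_energy \<nu> \<mu> + energy_distance \<nu> \<mu> = ennreal (e + (l - q))"
        by (simp flip: ennreal_plus)
      then have "2 * mutual_energy \<nu> \<mu> \<noteq> top" "energy_distance \<nu> \<mu> \<noteq> top"
        by (auto simp: ennreal_add_eq_top)
      then obtain k d where k: "mutual_energy \<nu> \<mu> = ennreal k" "k \<ge> 0"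
        and d: "energy_distance \<nu> \<mu> = ennreal d" "d \<ge> 0"
        by (cases "mutual_energy \<nu> \<mu>"; cases "energy_distance \<nu> \<mu>") (auto simp: ennreal_mult_top)
      have "2 * mutual_energy \<nu> \<mu> = ennreal (2 * k)" using k by (simp add: ennreal_mult')
      with sum d k real lq have "2 * k + d = e + (l - q)"
        by (simp flip: ennreal_plus)
      moreover have "l - s \<le> k" using m k by (simp add: ennreal_le_iff)
      ultimately show ?thesis
        using real d by (simp add: I\<mu> I\<nu> enn2ereal_ennreal)
    qed
  qed
  have "weighted_energy V \<mu> \<le> weighted_energy V \<nu>" if "\<nu> \<in> borel_prob_measures" for \<nu>
    using key[OF that] by (rule order_trans[rotated]) (simp add: I\<mu> enn2ereal_nonneg ereal_le_add_self)
  then have min: "is_energy_minimizer V \<mu>"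
    using \<mu> by (simp add: is_energy_minimizer_def)
  moreover have "\<nu> = \<mu>" if "is_energy_minimizer V \<nu>" for \<nu>
  proof -
    have \<nu>: "\<nu> \<in> borel_prob_measures" and "weighted_energy V \<nu> \<le> weighted_energy V \<mu>"
      using that \<mu> by (auto simp: is_energy_minimizer_def)
    with key[OF \<nu>] have "ereal (l + q + 1) + enn2ereal (energy_distance \<nu> \<mu>) \<le> ereal (l + q + 1)"
      by (simp add: I\<mu>)
    then have "energy_distance \<nu> \<mu> = 0"
      by (cases "energy_distance \<nu> \<mu>") (auto simp: enn2ereal_ennreal)
    then show ?thesis by (rule energy_distance_eq_0_imp_eq[OF \<nu> \<mu>])
  qed
  ultimately show ?thesis unfolding is_equilibrium_measure_def by blast
qed

text \<open>Restates the criterion for \<open>f\<close>, the negative of the usual logarithmic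
  potential of \<rho>. The potential of \<rho> for \<open>pos_kernel\<close> is
  \<open>ln_weight x - f x\<close> plus the constant \<open>G - 1\<close>, so the effective
  potential becomes \<open>V x - f x\<close> up to that constant.\<close>

lemma equilibrium_densityI:
  fixes V \<rho> f :: "real \<Rightarrow> real"
  assumes V [measurable]: "V \<in> borel_measurable borel"
    and bound: "\<And>x. \<bar>V x - ln_weight x\<bar> \<le> B"
    and \<rho> [measurable]: "\<rho> \<in> borel_measurable borel" and \<rho>_nonneg: "\<And>x. 0 \<le> \<rho> x"
    and mass: "has_bochner_integral lborel \<rho> 1"
    and f: "\<And>x. has_bochner_integral lborel (\<lambda>y. \<rho> y * ln \<bar>x - y\<bar>) (f x)"
    and ge: "\<And>x. l \<le> V x - f x"
    and eq: "\<And>x. \<rho> x > 0 \<Longrightarrow> V x - f x = l"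
  shows "is_equilibrium_measure V (density lborel (\<lambda>x. ennreal (\<rho> x)))"
proof -
  let ?\<mu> = "density lborel (\<lambda>x. ennreal (\<rho> x))"
  have "(\<integral>\<^sup>+ x. ennreal (\<rho> x) \<partial>lborel) = 1"
    using mass \<rho>_nonneg by (subst nn_integral_eq_integral) (auto simp: has_bochner_integral_iff)
  then have "prob_space ?\<mu>" by (intro prob_spaceI) (simp add: emeasure_density)
  then have \<mu>: "?\<mu> \<in> borel_prob_measures" by (simp add: borel_prob_measures_def)
  \<comment> \<open>The logarithmic moment is finite because \<open>f\<close> exists at x = 0 and
    \<open>ln_weight y\<close> is at most the absolute value of \<open>ln \<bar>y\<bar>\<close> plus
    1.\<close>
  have g: "integrable lborel (\<lambda>y. \<rho> y * ln_weight y)"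
  proof (rule Bochner_Integration.integrable_bound)
    show "integrable lborel (\<lambda>y. \<bar>\<rho> y * ln \<bar>0 - y\<bar>\<bar> + \<rho> y)"
      using mass f[of 0] by (auto simp: has_bochner_integral_iff)
    show "AE y in lborel. norm (\<rho> y * ln_weight y) \<le> norm (\<bar>\<rho> y * ln \<bar>0 - y\<bar>\<bar> + \<rho> y)"
    proof (rule AE_I2)
      fix y
      have "ln_weight y \<le> \<bar>ln \<bar>0 - y\<bar>\<bar> + 1" using ln_weight_le[of y 0] by simp
      then have "\<rho> y * ln_weight y \<le> \<rho> y * (\<bar>ln \<bar>0 - y\<bar>\<bar> + 1)"
        by (rule mult_left_mono[OF _ \<rho>_nonneg])
      also have "\<dots> = \<bar>\<rho> y * ln \<bar>0 - y\<bar>\<bar> + \<rho> y"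
        using \<rho>_nonneg[of y] by (simp add: abs_mult algebra_simps)
      finally show "norm (\<rho> y * ln_weight y) \<le> norm (\<bar>\<rho> y * ln \<bar>0 - y\<bar>\<bar> + \<rho> y)"
        using \<rho>_nonneg[of y] ln_weight_nonneg[of y] by simp
    qed
  qed simp
  define G where "G = (\<integral>y. \<rho> y * ln_weight y \<partial>lborel)"
  define P where "P = (\<lambda>x. ln_weight x - 1 + G - f x)"
  have hb: "has_bochner_integral lborel (\<lambda>y. \<rho> y * (ln_weight x + ln_weight y - 1 - ln \<bar>x - y\<bar>)) (P x)" for x
  proof -
    have "has_bochner_integral lborel
       (\<lambda>y. \<rho> y * (ln_weight x - 1) + \<rho> y * ln_weight y - \<rho> y * ln \<bar>x - y\<bar>) (1 * (ln_weight x - 1) + G - f x)"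
      using g f by (intro has_bochner_integral_diff has_bochner_integral_add has_bochner_integral_mult_left mass)
        (auto simp: has_bochner_integral_iff G_def)
    then show ?thesis by (simp add: P_def algebra_simps)
  qed
  have ae: "AE y in lborel. 0 \<le> \<rho> y * (ln_weight x + ln_weight y - 1 - ln \<bar>x - y\<bar>)" for x
    using AE_lborel_singleton[of x]
    by eventually_elim (use \<rho>_nonneg ln_weight_minus_ln_nonneg in auto)
  show ?thesis
  proof (rule equilibrium_measureI[OF \<mu> V bound])
    fix x
    have "(\<integral>\<^sup>+ y. pos_kernel x y \<partial>?\<mu>) = (\<integral>\<^sup>+ y. ennreal (\<rho> y) * pos_kernel x y \<partial>lborel)"
      by (rule nn_integral_density) auto
    also have "\<dots> = (\<integral>\<^sup>+ y. ennreal (\<rho> y * (ln_weight x + ln_weight y - 1 - ln \<bar>x - y\<bar>)) \<partial>lborel)"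
    proof (rule nn_integral_cong_AE)
      show "AE y in lborel. ennreal (\<rho> y) * pos_kernel x y
          = ennreal (\<rho> y * (ln_weight x + ln_weight y - 1 - ln \<bar>x - y\<bar>))"
        using AE_lborel_singleton[of x]
        by eventually_elim (use \<rho>_nonneg in \<open>auto simp: pos_kernel_eq ennreal_mult'\<close>)
    qed
    also have "\<dots> = ennreal (P x)"
      using hb[of x] ae by (subst nn_integral_eq_integral) (auto simp: has_bochner_integral_iff)
    finally show "(\<integral>\<^sup>+ y. pos_kernel x y \<partial>?\<mu>) = ennreal (P x)" .
    show "0 \<le> P x"
      using hb[of x] integral_nonneg_AE[OF ae, of x] by (simp add: has_bochner_integral_iff)
    show "l + G - 1 \<le> P x + (V x - ln_weight x)"
      using ge[of x] by (simp add: P_def)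
  next
    show "AE x in ?\<mu>. P x + (V x - ln_weight x) = l + G - 1"
      by (subst AE_density) (auto simp: P_def dest!: eq)
  qed
qed

section \<open>The support of a measure given by a density\<close>

lemma measure_support_density:
  fixes \<rho> :: "real \<Rightarrow> real"
  assumes \<rho> [measurable]: "\<rho> \<in> borel_measurable borel" and W: "open W"
    and pos: "\<And>x. x \<in> W \<Longrightarrow> \<rho> x > 0" and zero: "\<And>x. x \<notin> closure W \<Longrightarrow> \<rho> x = 0"
  shows "measure_support (density lborel (\<lambda>x. ennreal (\<rho> x))) = closure W"
proof (intro set_eqI iffI)
  fix x assume x: "x \<in> measure_support (density lborel (\<lambda>x. ennreal (\<rho> x)))"
  show "x \<in> closure W"
  proof (rule ccontr)
    assume "x \<notin> closure W"
    then have pos: "emeasure (density lborel (\<lambda>x. ennreal (\<rho> x))) (- closure W) > 0"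
      using x by (auto simp: measure_support_def closed_closure open_Compl)
    have "emeasure (density lborel (\<lambda>x. ennreal (\<rho> x))) (- closure W)
        = (\<integral>\<^sup>+ y. ennreal (\<rho> y) * indicator (- closure W) y \<partial>lborel)"
      by (rule emeasure_density) auto
    also have "\<dots> = 0"
      using zero by (subst nn_integral_0_iff_AE) (auto split: split_indicator)
    finally have "emeasure (density lborel (\<lambda>x. ennreal (\<rho> x))) (- closure W) = 0" .
    with pos show False by simp
  qed
next
  fix x assume x: "x \<in> closure W"
  show "x \<in> measure_support (density lborel (\<lambda>x. ennreal (\<rho> x)))"
    unfolding measure_support_def
  proof (intro CollectI allI impI)
    fix U assume U: "open U \<and> x \<in> U"
    with x have "U \<inter> closure W \<noteq> {}" by auto
    with U have ne: "U \<inter> W \<noteq> {}" by (simp add: open_Int_closure_eq_empty)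
    \<comment> \<open>A nonempty open set is not a null set.\<close>
    have "\<not> (AE y in lborel. y \<notin> U \<inter> W)"
    proof
      assume "AE y in lborel. y \<notin> U \<inter> W"
      then have "U \<inter> W \<in> null_sets lborel"
        using U W AE_iff_null_sets[of "U \<inter> W" lborel] by auto
      then show False
        using ne U W open_not_negligible[of "U \<inter> W"]
        by (auto simp: negligible_iff_null_sets intro: null_sets_completionI)
    qed
    moreover have "AE y in lborel. y \<notin> U \<inter> W" if "emeasure (density lborel (\<lambda>x. ennreal (\<rho> x))) U = 0"
    proof -
      have [measurable]: "U \<in> sets borel" using U by auto
      from that have "AE y in lborel. ennreal (\<rho> y) * indicator U y = 0"
        by (subst (asm) emeasure_density) (auto simp: nn_integral_0_iff_AE)
      then show ?thesis
        by eventually_elim (use pos in \<open>force simp: indicator_def split: if_splits\<close>)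
    qed
    ultimately show "emeasure (density lborel (\<lambda>x. ennreal (\<rho> x))) U > 0"
      by (auto simp: zero_less_iff_neq_zero)
  qed
qed

section \<open>Full support\<close>

lemma ln_sum_squares_minus_ln_max_bounded:
  fixes c :: real
  assumes c: "c > 0"
  shows "\<exists>B. \<forall>x. \<bar>ln (x\<^sup>2 + c\<^sup>2) / 2 - ln (max 1 \<bar>x\<bar>)\<bar> \<le> B"
proof (intro exI allI)
  fix x :: real
  define M where "M = max 1 \<bar>x\<bar>"
  define m where "m = min 1 (c\<^sup>2)"
  have m: "m > 0" "m \<le> 1" "m \<le> c\<^sup>2" using c by (auto simp: m_def)
  have M: "M \<ge> 1" "M\<^sup>2 \<ge> 1" by (auto simp: M_def)
  have "m * M\<^sup>2 \<le> x\<^sup>2 + c\<^sup>2"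
  proof (cases "\<bar>x\<bar> \<le> 1")
    case True
    then have "M = 1" by (simp add: M_def)
    with m show ?thesis by (simp add: add_increasing)
  next
    case False
    then have "M\<^sup>2 = x\<^sup>2" by (simp add: M_def max_def)
    moreover have "m * x\<^sup>2 \<le> 1 * x\<^sup>2" using m by (intro mult_right_mono) auto
    ultimately show ?thesis by (simp add: add_increasing2)
  qed
  then have "ln (m * M\<^sup>2) \<le> ln (x\<^sup>2 + c\<^sup>2)"
    using m M by (subst ln_le_cancel_iff) (auto intro: sum_squares_pos[OF c])
  then have lower: "ln m + 2 * ln M \<le> ln (x\<^sup>2 + c\<^sup>2)"
    using m M by (simp add: ln_mult_pos ln_realpow)
  have "x\<^sup>2 \<le> M\<^sup>2"
    using power_mono[of "\<bar>x\<bar>" M 2] by (simp add: M_def)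
  moreover have "c\<^sup>2 \<le> c\<^sup>2 * M\<^sup>2" using M by (simp add: mult_le_cancel_left1)
  ultimately have "x\<^sup>2 + c\<^sup>2 \<le> (1 + c\<^sup>2) * M\<^sup>2" by (simp add: distrib_right)
  then have "ln (x\<^sup>2 + c\<^sup>2) \<le> ln ((1 + c\<^sup>2) * M\<^sup>2)"
    using M c sum_squares_pos[OF c, of x] by (subst ln_le_cancel_iff) (auto intro!: mult_pos_pos add_pos_pos)
  then have upper: "ln (x\<^sup>2 + c\<^sup>2) \<le> ln (1 + c\<^sup>2) + 2 * ln M"
    using M c by (simp add: ln_mult_pos ln_realpow add_pos_pos)
  show "\<bar>ln (x\<^sup>2 + c\<^sup>2) / 2 - ln (max 1 \<bar>x\<bar>)\<bar> \<le> \<bar>ln (min 1 (c\<^sup>2))\<bar> / 2 + \<bar>ln (1 + c\<^sup>2)\<bar> / 2"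
    using lower upper unfolding M_def m_def by arith
qed

lemma external_field_eq:
  "external_field a b x = (1 + a) * (ln (x\<^sup>2 + (1 / b)\<^sup>2) / 2) - a * (ln (x\<^sup>2 + b\<^sup>2) / 2)"
  by (simp add: external_field_def power_divide)

lemma borel_measurable_external_field [measurable]: "external_field a b \<in> borel_measurable borel"
  unfolding external_field_def by measurable

text \<open>The coefficients \<open>1 + a\<close> and \<open>a\<close> differ by 1, so the field
  grows exactly like \<open>ln \<bar>x\<bar>\<close>, which is the growth of
  \<open>ln_weight\<close>.\<close>

lemma external_field_minus_ln_weight_bounded:
  assumes "a > 0" "b > 0"
  obtains B where "\<And>x. \<bar>external_field a b x - ln_weight x\<bar> \<le> B"
proof -
  obtain B1 where B1: "\<And>x. \<bar>ln (x\<^sup>2 + (1 / b)\<^sup>2) / 2 - ln (max 1 \<bar>x\<bar>)\<bar> \<le> B1"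
    using ln_sum_squares_minus_ln_max_bounded[of "1 / b"] assms by auto
  obtain B2 where B2: "\<And>x. \<bar>ln (x\<^sup>2 + b\<^sup>2) / 2 - ln (max 1 \<bar>x\<bar>)\<bar> \<le> B2"
    using ln_sum_squares_minus_ln_max_bounded[of b] assms by auto
  have "\<bar>external_field a b x - ln_weight x\<bar> \<le> (1 + a) * B1 + a * B2 + 1" for x
  proof -
    let ?u = "ln (x\<^sup>2 + (1 / b)\<^sup>2) / 2 - ln (max 1 \<bar>x\<bar>)" and ?v = "ln (x\<^sup>2 + b\<^sup>2) / 2 - ln (max 1 \<bar>x\<bar>)"
    have "external_field a b x - ln_weight x = (1 + a) * ?u - a * ?v - \<bar>x\<bar> / max 1 \<bar>x\<bar>"
      by (simp add: external_field_eq ln_weight_def algebra_simps)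
    moreover have "\<bar>(1 + a) * ?u\<bar> \<le> (1 + a) * B1" "\<bar>a * ?v\<bar> \<le> a * B2"
      using B1 B2 assms by (simp_all only: abs_mult) (auto intro!: mult_left_mono)
    moreover have "0 \<le> \<bar>x\<bar> / max 1 \<bar>x\<bar>" "\<bar>x\<bar> / max 1 \<bar>x\<bar> \<le> 1" by (auto simp: max_def)
    ultimately show ?thesis by linarith
  qed
  then show ?thesis by (rule that)
qed

lemma cauchy_log_potential_real:
  assumes c: "c > 0"
  shows "has_bochner_integral lborel (\<lambda>t. cauchy_density c t * ln \<bar>x - t\<bar>) (ln (x\<^sup>2 + c\<^sup>2) / 2)"
proof -
  have "ln ((t - x)\<^sup>2 + 0\<^sup>2) / 2 = ln \<bar>x - t\<bar>" for t
  proof (cases "t = x")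
    case False
    have "ln ((t - x)\<^sup>2) = ln (\<bar>x - t\<bar>\<^sup>2)" by (simp add: power2_commute)
    also have "\<dots> = 2 * ln \<bar>x - t\<bar>" using False by (subst ln_realpow) auto
    finally show ?thesis by simp
  qed simp
  with cauchy_log_potential[OF c order_refl, of x] show ?thesis by (simp only: add_0_left)
qed

lemma full_density_eq:
  assumes "b > 0"
  shows "full_density a b x = (1 + a) * cauchy_density (1 / b) x - a * cauchy_density b x"
proof -
  have P: "x\<^sup>2 + b\<^sup>2 > 0" and R: "x\<^sup>2 + 1 / b\<^sup>2 > 0"
    using sum_squares_pos[of b x] sum_squares_pos[of "1 / b" x] assms by (auto simp: power_divide)
  have aux: "((1 + a - b\<^sup>2 * a) * x\<^sup>2 + b\<^sup>2 + b\<^sup>2 * a - a) / (pi * b * P * R)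
      = (1 + a) * ((1 / b) / (pi * R)) - a * (b / (pi * P))"
    if "P > 0" "R > 0" "P = x\<^sup>2 + b\<^sup>2" "b\<^sup>2 * R = b\<^sup>2 * x\<^sup>2 + 1" for P R
  proof -
    have "(1 + a) * ((1 / b) / (pi * R)) - a * (b / (pi * P)) = ((1 + a) * P - a * (b\<^sup>2 * R)) / (pi * b * P * R)"
      using that(1,2) assms by (simp add: divide_simps power2_eq_square)
    also have "(1 + a) * P - a * (b\<^sup>2 * R) = (1 + a - b\<^sup>2 * a) * x\<^sup>2 + b\<^sup>2 + b\<^sup>2 * a - a"
      unfolding that(3,4) by (simp add: algebra_simps)
    finally show ?thesis by simp
  qed
  show ?thesis
    unfolding full_density_def cauchy_density_def
    using aux[OF P R] assms by (simp add: power_divide distrib_left)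
qed

text \<open>The bound on a says precisely that the coefficient of x^2 in the numerator is
  nonnegative; the constant term b^2 + (b^2 - 1) a is always positive. For b = 1 the coefficient is
  1, in accordance with the infinite critical value.\<close>

lemma full_density_pos:
  assumes "a > 0" "b \<ge> 1" "ereal a \<le> a_cr b"
  shows "full_density a b x > 0"
proof -
  have "b\<^sup>2 \<ge> 1" using assms by (simp add: one_le_power)
  have 1: "0 \<le> 1 + a - b\<^sup>2 * a"
  proof (cases "b = 1")
    case False
    with assms have "b\<^sup>2 > 1" by (simp add: one_less_power)
    with False assms show ?thesis by (simp add: a_cr_def field_simps)
  qed simp
  have "0 < b\<^sup>2 + (b\<^sup>2 - 1) * a" using \<open>b\<^sup>2 \<ge> 1\<close> assms by (intro add_pos_nonneg) auto
  with 1 have "0 < (1 + a - b\<^sup>2 * a) * x\<^sup>2 + b\<^sup>2 + b\<^sup>2 * a - a"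
    using mult_nonneg_nonneg[OF 1 zero_le_power2[of x]] by (simp add: algebra_simps)
  moreover have "x\<^sup>2 + b\<^sup>2 > 0" "x\<^sup>2 + 1 / b\<^sup>2 > 0"
    using sum_squares_pos[of b x] sum_squares_pos[of "1 / b" x] assms by (auto simp: power_divide)
  ultimately show ?thesis
    unfolding full_density_def using assms by (intro divide_pos_pos mult_pos_pos) auto
qed

lemma full_density_equilibrium:
  assumes a: "a > 0" and b: "b \<ge> 1" and le: "ereal a \<le> a_cr b"
  shows "is_equilibrium_measure (external_field a b) (density lborel (\<lambda>x. ennreal (full_density a b x)))"
    and "measure_support (density lborel (\<lambda>x. ennreal (full_density a b x))) = UNIV"
proof -
  note pos = full_density_pos[OF assms]
  have b0: "b > 0" "1 / b > 0" using b by auto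
  have [measurable]: "full_density a b \<in> borel_measurable borel" unfolding full_density_def by measurable
  obtain B where B: "\<And>x. \<bar>external_field a b x - ln_weight x\<bar> \<le> B"
    using external_field_minus_ln_weight_bounded[OF a b0(1)] by blast
  show "is_equilibrium_measure (external_field a b) (density lborel (\<lambda>x. ennreal (full_density a b x)))"
  \<comment> \<open>The function \<open>f\<close> of this density is the field itself, so the
    effective potential vanishes on the whole line.\<close>
  proof (rule equilibrium_densityI[where l = 0 and f = "external_field a b", OF _ B])
    have "has_bochner_integral lborel (\<lambda>x. (1 + a) * cauchy_density (1 / b) x - a * cauchy_density b x) ((1 + a) * 1 - a * 1)"
      by (intro has_bochner_integral_diff has_bochner_integral_mult_right has_bochner_integral_cauchy_density b0)
    then show "has_bochner_integral lborel (full_density a b) 1"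
      by (simp add: full_density_eq[OF b0(1), abs_def])
  next
    fix x
    have "has_bochner_integral lborel (\<lambda>y. (1 + a) * (cauchy_density (1 / b) y * ln \<bar>x - y\<bar>)
        - a * (cauchy_density b y * ln \<bar>x - y\<bar>)) (external_field a b x)"
      unfolding external_field_eq
      by (intro has_bochner_integral_diff has_bochner_integral_mult_right cauchy_log_potential_real b0)
    then show "has_bochner_integral lborel (\<lambda>y. full_density a b y * ln \<bar>x - y\<bar>) (external_field a b x)"
      by (simp add: full_density_eq[OF b0(1)] algebra_simps)
  qed (use pos in \<open>auto intro: less_imp_le\<close>)
  show "measure_support (density lborel (\<lambda>x. ennreal (full_density a b x))) = UNIV"
    using measure_support_density[of "full_density a b" UNIV] pos by simp
qed

section \<open>Support on an interval\<close>

text \<open>A bijection from the line onto (- A, A) under which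
  \<open>sqrt (A\<^sup>2 - y\<^sup>2)\<close> becomes \<open>A / sqrt (1 + t\<^sup>2)\<close> and
  y^2 a rational function of t^2.\<close>

definition line_to_interval :: "real \<Rightarrow> real \<Rightarrow> real" where
  "line_to_interval A t = A * t / sqrt (1 + t\<^sup>2)"

lemma borel_measurable_line_to_interval [measurable]: "line_to_interval A \<in> borel_measurable borel"
  unfolding line_to_interval_def by measurable

lemma one_plus_square_pos [simp]: "0 < 1 + (t::real)\<^sup>2" "1 + t\<^sup>2 \<noteq> 0" "\<not> 1 + t\<^sup>2 < 0"
proof -
  show *: "0 < 1 + t\<^sup>2" by (simp add: add_pos_nonneg)
  then show "1 + t\<^sup>2 \<noteq> 0" "\<not> 1 + t\<^sup>2 < 0" by (auto simp del: not_less)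
qed

lemma DERIV_line_to_interval:
  "(line_to_interval A has_real_derivative A / (sqrt (1 + t\<^sup>2)) ^ 3) (at t)"
proof -
  define s where "s = sqrt (1 + t\<^sup>2)"
  have s: "s > 0" "s\<^sup>2 = 1 + t\<^sup>2" by (simp_all add: s_def less_imp_le)
  have d: "((\<lambda>t. sqrt (1 + t\<^sup>2)) has_real_derivative t / s) (at t)"
    unfolding s_def using one_plus_square_pos(1)[of t]
    by (auto intro!: derivative_eq_intros simp: divide_simps)
  have "(line_to_interval A has_real_derivative (A * s - A * t * (t / s)) / (s * s)) (at t)"
    unfolding line_to_interval_def s_def
    by (rule DERIV_divide[OF _ d[unfolded s_def]]) (auto intro!: derivative_eq_intros simp: add_pos_nonneg less_imp_neq[symmetric])
  also have "(A * s - A * t * (t / s)) / (s * s) = A * (s\<^sup>2 - t\<^sup>2) / s ^ 3"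
    using s(1) by (simp add: field_simps power2_eq_square power3_eq_cube)
  also have "\<dots> = A / s ^ 3" using s by simp
  finally show ?thesis by (simp add: s_def)
qed

lemma line_to_interval_square: "(line_to_interval A t)\<^sup>2 = A\<^sup>2 * t\<^sup>2 / (1 + t\<^sup>2)"
  by (simp add: line_to_interval_def power_divide power_mult_distrib less_imp_le)

lemma line_to_interval_uminus: "line_to_interval A (- t) = - line_to_interval A t"
  by (simp add: line_to_interval_def)

lemma inj_line_to_interval:
  assumes "A > 0"
  shows "inj (line_to_interval A)"
proof -
  have "strict_mono (line_to_interval A)"
    by (rule DERIV_pos_imp_increasing[THEN strict_monoI])
       (use assms DERIV_line_to_interval in \<open>auto intro!: exI divide_pos_pos\<close>)
  then show ?thesis by (rule strict_mono_imp_inj_on)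
qed

lemma range_line_to_interval:
  assumes A: "A > 0"
  shows "range (line_to_interval A) = {-A<..<A}"
proof (intro set_eqI iffI)
  fix y assume "y \<in> range (line_to_interval A)"
  then obtain t where "y = line_to_interval A t" by blast
  then have "y\<^sup>2 = A\<^sup>2 * (t\<^sup>2 / (1 + t\<^sup>2))" by (simp add: line_to_interval_square)
  also have "\<dots> < A\<^sup>2 * 1" using A one_plus_square_pos(1)[of t] by (intro mult_strict_left_mono) auto
  finally have "\<bar>y\<bar> < A" using A power2_less_imp_less[of "\<bar>y\<bar>" A] by simp
  then show "y \<in> {-A<..<A}" by auto
next
  fix y assume "y \<in> {-A<..<A}"
  then have "\<bar>y\<bar> < A" by auto
  then have "y\<^sup>2 < A\<^sup>2" using power_strict_mono[of "\<bar>y\<bar>" A 2] by simp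
  then have p: "A\<^sup>2 - y\<^sup>2 > 0" by simp
  let ?t = "y / sqrt (A\<^sup>2 - y\<^sup>2)"
  have "1 + ?t\<^sup>2 = A\<^sup>2 / (A\<^sup>2 - y\<^sup>2)" using p by (simp add: power_divide field_simps)
  then have "sqrt (1 + ?t\<^sup>2) = A / sqrt (A\<^sup>2 - y\<^sup>2)" using A by (simp add: real_sqrt_divide)
  then have "line_to_interval A ?t = y" using A p by (simp add: line_to_interval_def)
  then show "y \<in> range (line_to_interval A)" by (metis rangeI)
qed

text \<open>Here \<open>m\<close> is the pulled back density including the Jacobian.
  \<open>F\<close> is later the constant 1 for the mass and \<open>ln \<bar>x - y\<bar>\<close> for
  the potential. The change of variables takes place for the completed measure; Borel measurability
  of \<rho> and \<open>F\<close> leads back to \<open>lborel\<close>.\<close>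

lemma has_bochner_integral_line_to_interval:
  fixes \<rho> F :: "real \<Rightarrow> real"
  assumes A: "A > 0"
    and [measurable]: "\<rho> \<in> borel_measurable borel" "F \<in> borel_measurable borel"
    and zero: "\<And>y. y \<notin> {-A<..<A} \<Longrightarrow> \<rho> y = 0"
    and m: "\<And>t. m t = A / (sqrt (1 + t\<^sup>2)) ^ 3 * \<rho> (line_to_interval A t)"
    and int: "has_bochner_integral lborel (\<lambda>t. m t * F (line_to_interval A t)) v"
  shows "has_bochner_integral lborel (\<lambda>y. \<rho> y * F y) v"
proof -
  let ?g' = "\<lambda>t. A / (sqrt (1 + t\<^sup>2)) ^ 3"
  let ?f = "\<lambda>y. \<rho> y * F y"
  let ?h = "\<lambda>t. \<bar>?g' t\<bar> * ?f (line_to_interval A t)"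
  have h: "?h = (\<lambda>t. m t * F (line_to_interval A t))"
    using A by (auto simp: m abs_mult less_imp_le)
  have int_leb: "integrable lebesgue ?h" "integral\<^sup>L lebesgue ?h = v"
    using int unfolding h has_bochner_integral_iff
    by (auto simp: integrable_completion integral_completion)
  then have 1: "?h absolutely_integrable_on UNIV"
    by (simp add: set_integrable_def)
  have "integral UNIV ?h = v"
    using set_lebesgue_integral_eq_integral(2)[OF 1] int_leb
    by (simp add: set_lebesgue_integral_def)
  with 1 has_absolute_integral_change_of_variables_1'[of UNIV "line_to_interval A" ?g' ?f v]
  have 2: "?f absolutely_integrable_on {-A<..<A}" "integral {-A<..<A} ?f = v"
    using DERIV_line_to_interval inj_line_to_interval[OF A] range_line_to_interval[OF A] by auto
  have "(\<lambda>y. indicator {-A<..<A} y *\<^sub>R ?f y) = ?f"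
  proof
    show "indicator {-A<..<A} y *\<^sub>R ?f y = ?f y" for y
      using zero[of y] by (cases "y \<in> {-A<..<A}") simp_all
  qed
  with 2 set_lebesgue_integral_eq_integral(2)[OF 2(1)]
  have "integrable lebesgue ?f" "integral\<^sup>L lebesgue ?f = v"
    by (simp_all add: set_integrable_def set_lebesgue_integral_def)
  then show ?thesis
    unfolding has_bochner_integral_iff by (auto simp: integrable_completion integral_completion)
qed

section \<open>Logarithmic potentials after the substitution\<close>

definition interval_log_potential :: "real \<Rightarrow> real \<Rightarrow> real \<Rightarrow> real" where
  "interval_log_potential A c x =
     (if \<bar>x\<bar> \<le> A then ln (x\<^sup>2 + (A\<^sup>2 - x\<^sup>2) * c\<^sup>2) / 2 else ln (\<bar>x\<bar> + c * sqrt (x\<^sup>2 - A\<^sup>2)))"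

lemma finite_square_eq: "finite {t::real. t\<^sup>2 = k}"
  by (rule finite_subset[of _ "{sqrt k, - sqrt k}"]) (auto simp: real_sqrt_abs)

lemma AE_lborel_not_in_finite: "finite N \<Longrightarrow> AE t in lborel. t \<notin> (N :: real set)"
  by (intro AE_not_in finite_imp_null_set_lborel)

text \<open>The zeros of the quadratic in t decide. Inside the interval they are real, and their two
  logarithmic potentials are averaged; outside they are purely imaginary, which calls for a positive
  \<kappa>; at the endpoints the quadratic is constant.\<close>

lemma cauchy_log_potential_quadratic:
  assumes A: "A > 0" and c: "c > 0"
  shows "has_bochner_integral lborel
    (\<lambda>t. cauchy_density c t * (ln \<bar>x\<^sup>2 + (x\<^sup>2 - A\<^sup>2) * t\<^sup>2\<bar> / 2)) (interval_log_potential A c x)"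
proof -
  note one = has_bochner_integral_cauchy_density[OF c]
  show ?thesis
  proof (cases rule: linorder_cases[of "\<bar>x\<bar>" A])
    case less
    then have p: "A\<^sup>2 - x\<^sup>2 > 0" using power_strict_mono[of "\<bar>x\<bar>" A 2] by simp
    define u where "u = x / sqrt (A\<^sup>2 - x\<^sup>2)"
    have u: "(A\<^sup>2 - x\<^sup>2) * u\<^sup>2 = x\<^sup>2" using p by (simp add: u_def power_divide)
    have "has_bochner_integral lborel
      (\<lambda>t. cauchy_density c t * (ln (A\<^sup>2 - x\<^sup>2) / 2) + (cauchy_density c t * ln \<bar>u - t\<bar>
          + cauchy_density c t * ln \<bar>- u - t\<bar>) / 2)
      (1 * (ln (A\<^sup>2 - x\<^sup>2) / 2) + (ln (u\<^sup>2 + c\<^sup>2) / 2 + ln ((- u)\<^sup>2 + c\<^sup>2) / 2) / 2)"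
      by (intro has_bochner_integral_add has_bochner_integral_mult_left has_bochner_integral_divide
          one cauchy_log_potential_real c)
    moreover have "1 * (ln (A\<^sup>2 - x\<^sup>2) / 2) + (ln (u\<^sup>2 + c\<^sup>2) / 2 + ln ((- u)\<^sup>2 + c\<^sup>2) / 2) / 2
        = interval_log_potential A c x"
    proof -
      have "ln (A\<^sup>2 - x\<^sup>2) + ln (u\<^sup>2 + c\<^sup>2) = ln ((A\<^sup>2 - x\<^sup>2) * (u\<^sup>2 + c\<^sup>2))"
        using p sum_squares_pos[OF c, of u] by (simp add: ln_mult_pos)
      also have "(A\<^sup>2 - x\<^sup>2) * (u\<^sup>2 + c\<^sup>2) = x\<^sup>2 + (A\<^sup>2 - x\<^sup>2) * c\<^sup>2"
        by (simp add: distrib_left u)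
      finally show ?thesis using less by (simp add: interval_log_potential_def)
    qed
    moreover have ae: "AE t in lborel. cauchy_density c t * (ln \<bar>x\<^sup>2 + (x\<^sup>2 - A\<^sup>2) * t\<^sup>2\<bar> / 2)
       = cauchy_density c t * (ln (A\<^sup>2 - x\<^sup>2) / 2) + (cauchy_density c t * ln \<bar>u - t\<bar>
          + cauchy_density c t * ln \<bar>- u - t\<bar>) / 2"
      using AE_lborel_singleton[of u] AE_lborel_singleton[of "- u"]
    proof eventually_elim
      case (elim t)
      have "x\<^sup>2 + (x\<^sup>2 - A\<^sup>2) * t\<^sup>2 = - ((A\<^sup>2 - x\<^sup>2) * ((u - t) * (- u - t)))"
        using u by (simp add: algebra_simps power2_eq_square)
      then have "\<bar>x\<^sup>2 + (x\<^sup>2 - A\<^sup>2) * t\<^sup>2\<bar> = (A\<^sup>2 - x\<^sup>2) * (\<bar>u - t\<bar> * \<bar>- u - t\<bar>)"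
        using p by (simp add: abs_mult del: mult_minus_right mult_minus_left)
      also have "ln \<dots> = ln (A\<^sup>2 - x\<^sup>2) + (ln \<bar>u - t\<bar> + ln \<bar>- u - t\<bar>)"
        using p elim by (subst ln_mult_pos; (subst ln_mult_pos)?) auto
      finally show ?case by (simp add: algebra_simps add_divide_distrib)
    qed
    ultimately show ?thesis
      by (subst has_bochner_integral_cong_AE[OF _ _ ae]) auto
  next
    case equal
    then have "x\<^sup>2 = A\<^sup>2" by (metis power2_abs)
    then show ?thesis
      using has_bochner_integral_mult_left[OF one, of "ln (A\<^sup>2) / 2"] equal
      by (simp add: interval_log_potential_def)
  next
    case greater
    then have p: "x\<^sup>2 - A\<^sup>2 > 0" using power_strict_mono[of A "\<bar>x\<bar>" 2] A by simp
    define s where "s = sqrt (x\<^sup>2 - A\<^sup>2)"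
    have s: "s > 0" "s\<^sup>2 = x\<^sup>2 - A\<^sup>2" using p by (simp_all add: s_def)
    define \<kappa> where "\<kappa> = \<bar>x\<bar> / s"
    have \<kappa>: "\<kappa> > 0" using s greater A by (simp add: \<kappa>_def)
    have "has_bochner_integral lborel
      (\<lambda>t. cauchy_density c t * (ln (s\<^sup>2) / 2) + cauchy_density c t * (ln ((t - 0)\<^sup>2 + \<kappa>\<^sup>2) / 2))
      (1 * (ln (s\<^sup>2) / 2) + ln (0\<^sup>2 + (\<kappa> + c)\<^sup>2) / 2)"
      by (intro has_bochner_integral_add has_bochner_integral_mult_left one cauchy_log_potential c)
         (use \<kappa> in auto)
    moreover have "1 * (ln (s\<^sup>2) / 2) + ln (0\<^sup>2 + (\<kappa> + c)\<^sup>2) / 2 = interval_log_potential A c x"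
    proof -
      have "1 * (ln (s\<^sup>2) / 2) + ln (0\<^sup>2 + (\<kappa> + c)\<^sup>2) / 2 = ln s + ln (\<kappa> + c)"
        using s(1) \<kappa> c by (simp add: ln_realpow)
      also have "\<dots> = ln (s * (\<kappa> + c))" using s(1) \<kappa> c by (simp add: ln_mult_pos)
      also have "s * (\<kappa> + c) = \<bar>x\<bar> + c * s" using s(1) by (simp add: \<kappa>_def distrib_left mult.commute)
      finally show ?thesis using greater by (simp add: interval_log_potential_def s_def)
    qed
    moreover have "cauchy_density c t * (ln (s\<^sup>2) / 2) + cauchy_density c t * (ln ((t - 0)\<^sup>2 + \<kappa>\<^sup>2) / 2)
        = cauchy_density c t * (ln \<bar>x\<^sup>2 + (x\<^sup>2 - A\<^sup>2) * t\<^sup>2\<bar> / 2)" for t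
    proof -
      have "s\<^sup>2 * \<kappa>\<^sup>2 = x\<^sup>2" using s(1) by (simp add: \<kappa>_def power_divide)
      then have "x\<^sup>2 + (x\<^sup>2 - A\<^sup>2) * t\<^sup>2 = s\<^sup>2 * (t\<^sup>2 + \<kappa>\<^sup>2)"
        by (simp add: s(2)[symmetric] distrib_left)
      moreover have "t\<^sup>2 + \<kappa>\<^sup>2 > 0" by (rule sum_squares_pos[OF \<kappa>])
      ultimately have "ln \<bar>x\<^sup>2 + (x\<^sup>2 - A\<^sup>2) * t\<^sup>2\<bar> = ln (s\<^sup>2) + ln (t\<^sup>2 + \<kappa>\<^sup>2)"
        using s(1) by (simp add: abs_mult ln_mult_pos)
      then show ?thesis by (simp add: algebra_simps add_divide_distrib)
    qed
    ultimately show ?thesis by (simp only:)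
  qed
qed

text \<open>
  The Cauchy density is even, so \<open>ln \<bar>x - y\<bar>\<close> may be replaced by \<open>ln \<bar>x\<^sup>2 - y\<^sup>2\<bar> / 2\<close>,
  and \<open>x\<^sup>2 - y\<^sup>2\<close> is rational in \<open>t\<close>.
\<close>

lemma cauchy_log_potential_line_to_interval:
  assumes A: "A > 0" and c: "c > 0"
  shows "has_bochner_integral lborel (\<lambda>t. cauchy_density c t * ln \<bar>x - line_to_interval A t\<bar>)
     (interval_log_potential A c x - ln (1 + c))"
proof -
  let ?\<psi> = "line_to_interval A" and ?P = "cauchy_density c"
  let ?u = "\<lambda>t. ln \<bar>x - ?\<psi> t\<bar>" and ?w = "\<lambda>t. ln \<bar>x + ?\<psi> t\<bar>"
  let ?s = "\<lambda>t. ln \<bar>x\<^sup>2 + (x\<^sup>2 - A\<^sup>2) * t\<^sup>2\<bar> / 2 - ln (1 + t\<^sup>2) / 2"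
  let ?v = "interval_log_potential A c x - ln (1 + c)"
  have 1: "has_bochner_integral lborel (\<lambda>t. ?P t * ?s t) ?v"
  proof -
    \<comment> \<open>The denominator 1 + t^2 of x^2 - y^2 contributes the potential at x = 0 with
      \<kappa> = 1, which is the source of \<open>ln (1 + c)\<close>.\<close>
    have "has_bochner_integral lborel (\<lambda>t. ?P t * (ln \<bar>x\<^sup>2 + (x\<^sup>2 - A\<^sup>2) * t\<^sup>2\<bar> / 2) - ?P t * (ln ((t - 0)\<^sup>2 + 1\<^sup>2) / 2))
       (interval_log_potential A c x - ln (0\<^sup>2 + (1 + c)\<^sup>2) / 2)"
      by (intro has_bochner_integral_diff cauchy_log_potential_quadratic A c cauchy_log_potential) simp
    then show ?thesis using c by (simp add: ln_realpow right_diff_distrib add.commute)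
  qed
  have ae: "AE t in lborel. ?u t + ?w t = 2 * ?s t \<and> ?u t \<le> max 0 (ln (\<bar>x\<bar> + A)) \<and> ?w t \<le> max 0 (ln (\<bar>x\<bar> + A))"
  proof -
    \<comment> \<open>At these t one of the two logarithms has argument 0 and takes a default value,
      so the sum rule would fail.\<close>
    have "finite {t. x\<^sup>2 + (x\<^sup>2 - A\<^sup>2) * t\<^sup>2 = 0}"
    proof (cases "x\<^sup>2 = A\<^sup>2")
      case False
      then have "{t. x\<^sup>2 + (x\<^sup>2 - A\<^sup>2) * t\<^sup>2 = 0} \<subseteq> {t. t\<^sup>2 = - x\<^sup>2 / (x\<^sup>2 - A\<^sup>2)}"
        by (auto simp: field_simps)
      then show ?thesis by (rule finite_subset) (rule finite_square_eq)
    qed (use A in simp)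
    from AE_lborel_not_in_finite[OF this] show ?thesis
    proof eventually_elim
      case (elim t)
      then have ne: "x\<^sup>2 + (x\<^sup>2 - A\<^sup>2) * t\<^sup>2 \<noteq> 0" by simp
      have prod: "(x - ?\<psi> t) * (x + ?\<psi> t) = (x\<^sup>2 + (x\<^sup>2 - A\<^sup>2) * t\<^sup>2) / (1 + t\<^sup>2)"
      proof -
        have "(x - ?\<psi> t) * (x + ?\<psi> t) = x\<^sup>2 - (?\<psi> t)\<^sup>2" by (simp add: power2_eq_square algebra_simps)
        also have "\<dots> = (x\<^sup>2 * (1 + t\<^sup>2) - A\<^sup>2 * t\<^sup>2) / (1 + t\<^sup>2)"
          unfolding line_to_interval_square using one_plus_square_pos(1)[of t]
          by (simp add: diff_divide_distrib less_imp_neq[symmetric])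
        finally show ?thesis by (simp add: algebra_simps)
      qed
      with ne have ne2: "(x - ?\<psi> t) * (x + ?\<psi> t) \<noteq> 0"
        using one_plus_square_pos(1)[of t] by (simp add: less_imp_neq[symmetric])
      then have ne3: "\<bar>x - ?\<psi> t\<bar> > 0" "\<bar>x + ?\<psi> t\<bar> > 0" by auto
      have "?u t + ?w t = ln (\<bar>x - ?\<psi> t\<bar> * \<bar>x + ?\<psi> t\<bar>)"
        using ne3 by (simp only: ln_mult_pos)
      also have "\<bar>x - ?\<psi> t\<bar> * \<bar>x + ?\<psi> t\<bar> = \<bar>x\<^sup>2 + (x\<^sup>2 - A\<^sup>2) * t\<^sup>2\<bar> / (1 + t\<^sup>2)"
        unfolding abs_mult[symmetric] prod using one_plus_square_pos(1)[of t] by (simp add: abs_divide)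
      also have "ln \<dots> = 2 * ?s t"
        using ne by (subst ln_div) auto
      finally have eq: "?u t + ?w t = 2 * ?s t" .
      have "\<bar>?\<psi> t\<bar> < A" using range_line_to_interval[OF A] rangeI[of ?\<psi> t] by auto
      then have "ln \<bar>x - ?\<psi> t\<bar> \<le> ln (\<bar>x\<bar> + A)" "ln \<bar>x + ?\<psi> t\<bar> \<le> ln (\<bar>x\<bar> + A)"
        using ne3 by (auto intro!: ln_mono)
      with eq show ?case by (simp add: le_max_iff_disj)
    qed
  qed
  \<comment> \<open>So far only the symmetrised integrand is known to be integrable. Both
    \<open>?u\<close> and \<open>?w\<close> are bounded above and their sum is
    \<open>2 * ?s t\<close>, so each of them is also bounded below in terms of
    \<open>?s\<close>.\<close>
  have intu: "integrable lborel (\<lambda>t. ?P t * ?u t)"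
  proof (rule Bochner_Integration.integrable_bound)
    show "integrable lborel (\<lambda>t. ?P t * max 0 (ln (\<bar>x\<bar> + A)) + 2 * \<bar>?P t * ?s t\<bar>)"
      using 1 has_bochner_integral_cauchy_density[OF c] by (auto simp: has_bochner_integral_iff)
    show "AE t in lborel. norm (?P t * ?u t) \<le> norm (?P t * max 0 (ln (\<bar>x\<bar> + A)) + 2 * \<bar>?P t * ?s t\<bar>)"
      using ae
    proof eventually_elim
      case (elim t)
      have "\<bar>u\<bar> \<le> m + 2 * \<bar>s\<bar>" if "u + w = 2 * s" "u \<le> m" "w \<le> m" "0 \<le> m" for u w s m :: real
        using that by arith
      from this[of "?u t" "?w t" "?s t" "max 0 (ln (\<bar>x\<bar> + A))"] elim
      have "\<bar>?u t\<bar> \<le> max 0 (ln (\<bar>x\<bar> + A)) + 2 * \<bar>?s t\<bar>" by simp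
      then have "?P t * \<bar>?u t\<bar> \<le> ?P t * (max 0 (ln (\<bar>x\<bar> + A)) + 2 * \<bar>?s t\<bar>)"
        by (rule mult_left_mono) (rule cauchy_density_nonneg[OF c])
      moreover have "norm (p * u) \<le> norm (p * m + 2 * \<bar>p * s\<bar>)"
        if "p * \<bar>u\<bar> \<le> p * (m + 2 * \<bar>s\<bar>)" "0 \<le> p" "0 \<le> m" for p u m s :: real
      proof -
        have "norm (p * u) \<le> p * m + 2 * \<bar>p * s\<bar>"
          using that by (simp add: abs_mult distrib_left mult.left_commute)
        then show ?thesis by simp
      qed
      ultimately show ?case using cauchy_density_nonneg[OF c, of t] by simp
    qed
  qed simp
  define I where "I = (\<integral>t. ?P t * ?u t \<partial>lborel)"
  have u: "has_bochner_integral lborel (\<lambda>t. ?P t * ?u t) I"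
    using intu by (simp add: I_def has_bochner_integral_iff)
  \<comment> \<open>The reflection of t preserves the even Cauchy density and exchanges
    \<open>?u\<close> and \<open>?w\<close>.\<close>
  have "has_bochner_integral lborel (\<lambda>t. ?P t * ?w t) I"
    using lborel_has_bochner_integral_real_affine_iff[of "-1" "\<lambda>t. ?P t * ?u t" I 0] u
    by (simp add: line_to_interval_uminus cauchy_density_def)
  from has_bochner_integral_add[OF u this]
  have sum: "has_bochner_integral lborel (\<lambda>t. ?P t * ?u t + ?P t * ?w t) (I + I)" .
  have twice: "has_bochner_integral lborel (\<lambda>t. 2 * (?P t * ?s t)) (2 * ?v)"
    by (rule has_bochner_integral_mult_right) (use 1 in auto)
  have "AE t in lborel. ?P t * ?u t + ?P t * ?w t = 2 * (?P t * ?s t)"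
    using ae
  proof eventually_elim
    case (elim t)
    have "?P t * ?u t + ?P t * ?w t = ?P t * (?u t + ?w t)" by (simp only: distrib_left)
    also have "\<dots> = ?P t * (2 * ?s t)" using elim by (simp only:)
    finally show ?case by (simp only: mult.left_commute)
  qed
  from has_bochner_integral_cong_AE[OF _ _ this] sum
  have "has_bochner_integral lborel (\<lambda>t. 2 * (?P t * ?s t)) (I + I)" by simp
  from has_bochner_integral_eq[OF this twice] have "I = ?v" by simp
  with u show ?thesis by simp
qed

text \<open>Both sides vanish at s = 0. The derivative of ln (X - k s) - ln (X + k s) in s is -2 k X
  / (X^2 - k^2 s^2). Since \<open>p * c = q * d\<close>, the weighted numerators agree, and the
  larger scale d has the smaller denominator, so its side decreases at least as fast.\<close>

lemma ln_ratio_comparison: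
  fixes p q c d X s :: real
  assumes "0 \<le> s" "0 \<le> c" "c \<le> d" "d * s < X" "p * c = q * d" "0 \<le> q"
  shows "q * (ln (X - d * s) - ln (X + d * s)) \<le> p * (ln (X - c * s) - ln (X + c * s))"
proof -
  define H where "H = (\<lambda>\<sigma>. p * (ln (X - c * \<sigma>) - ln (X + c * \<sigma>)) - q * (ln (X - d * \<sigma>) - ln (X + d * \<sigma>)))"
  have "H 0 \<le> H s"
  proof (rule DERIV_nonneg_imp_nondecreasing[OF assms(1)])
    fix \<sigma> assume \<sigma>: "0 \<le> \<sigma>" "\<sigma> \<le> s"
    have d\<sigma>: "d * \<sigma> < X" using mult_left_mono[OF \<sigma>(2), of d] assms by simp
    have c\<sigma>: "c * \<sigma> \<le> d * \<sigma>" using \<sigma> assms by (intro mult_right_mono) auto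
    have nn: "0 \<le> c * \<sigma>" using \<sigma> assms by simp
    have pos: "X - c * \<sigma> > 0" "X + c * \<sigma> > 0" "X - d * \<sigma> > 0" "X + d * \<sigma> > 0" "X > 0"
      using d\<sigma> c\<sigma> nn by linarith+
    have frac: "- k / (X - k * \<sigma>) - k / (X + k * \<sigma>) = - (2 * k * X) / (X\<^sup>2 - (k * \<sigma>)\<^sup>2)"
      if "X - k * \<sigma> > 0" "X + k * \<sigma> > 0" for k
    proof -
      have "X\<^sup>2 - (k * \<sigma>)\<^sup>2 = (X - k * \<sigma>) * (X + k * \<sigma>)" by (simp add: power2_eq_square algebra_simps)
      moreover have "- k / m - k / n = - (k * (m + n)) / (m * n)" if "m > 0" "n > 0" for m n
        using that by (simp add: field_simps)
      from this[OF that] have "- k / (X - k * \<sigma>) - k / (X + k * \<sigma>)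
          = - (2 * k * X) / ((X - k * \<sigma>) * (X + k * \<sigma>))" by (simp add: mult_ac)
      ultimately show ?thesis by (simp only:)
    qed
    have der: "((\<lambda>\<sigma>. ln (X - k * \<sigma>) - ln (X + k * \<sigma>)) has_real_derivative - (2 * k * X) / (X\<^sup>2 - (k * \<sigma>)\<^sup>2)) (at \<sigma>)"
      if "X - k * \<sigma> > 0" "X + k * \<sigma> > 0" for k
      unfolding frac[OF that, symmetric] using that
      by (auto intro!: derivative_eq_intros)
    have sq: "(c * \<sigma>)\<^sup>2 \<le> (d * \<sigma>)\<^sup>2" by (rule power_mono[OF c\<sigma> nn])
    have sqX: "(d * \<sigma>)\<^sup>2 < X\<^sup>2" using d\<sigma> c\<sigma> nn by (intro power_strict_mono) auto
    have *: "2 * (q * d) * X / (X\<^sup>2 - (c * \<sigma>)\<^sup>2) \<le> 2 * (q * d) * X / (X\<^sup>2 - (d * \<sigma>)\<^sup>2)"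
      using sq sqX assms pos by (intro divide_left_mono mult_pos_pos mult_nonneg_nonneg) auto
    have "0 \<le> p * (- (2 * c * X) / (X\<^sup>2 - (c * \<sigma>)\<^sup>2)) - q * (- (2 * d * X) / (X\<^sup>2 - (d * \<sigma>)\<^sup>2))"
    proof -
      have "p * (- (2 * c * X) / P) - q * (- (2 * d * X) / R) = 2 * (q * d) * X / R - 2 * (p * c) * X / P" for P R
        by (simp add: algebra_simps)
      with * show ?thesis unfolding assms(5) by simp
    qed
    moreover have "(H has_real_derivative p * (- (2 * c * X) / (X\<^sup>2 - (c * \<sigma>)\<^sup>2)) - q * (- (2 * d * X) / (X\<^sup>2 - (d * \<sigma>)\<^sup>2))) (at \<sigma>)"
      unfolding H_def by (intro DERIV_diff DERIV_cmult der pos)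
    ultimately show "\<exists>y. (H has_real_derivative y) (at \<sigma>) \<and> 0 \<le> y" by blast
  qed
  then show ?thesis by (simp add: H_def)
qed

text \<open>The relation between c and c0 says that the substitution sends t = i c to a point y with
  y^2 = - c0^2. It makes \<open>x\<^sup>2 + (A\<^sup>2 - x\<^sup>2) * c\<^sup>2\<close> a constant
  multiple of \<open>x\<^sup>2 + c0\<^sup>2\<close>. Outside the interval this expression is a
  product of two linear factors of which the potential sees only one; the difference is the
  logarithmic ratio.\<close>

lemma ln_minus_interval_log_potential:
  assumes c: "0 < c" "c < 1" and c0: "c0 > 0" and A: "A > 0" and eq: "c\<^sup>2 * (A\<^sup>2 + c0\<^sup>2) = c0\<^sup>2"
  shows "\<bar>x\<bar> \<le> A \<Longrightarrow> ln (x\<^sup>2 + c0\<^sup>2) / 2 - interval_log_potential A c x = - ln (1 - c\<^sup>2) / 2"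
    and "\<bar>x\<bar> > A \<Longrightarrow> ln (x\<^sup>2 + c0\<^sup>2) / 2 - interval_log_potential A c x
      = - ln (1 - c\<^sup>2) / 2 + (ln (\<bar>x\<bar> - c * sqrt (x\<^sup>2 - A\<^sup>2)) - ln (\<bar>x\<bar> + c * sqrt (x\<^sup>2 - A\<^sup>2))) / 2"
proof -
  have c1: "1 - c\<^sup>2 > 0" using c by (simp add: power_less_one_iff)
  have "x\<^sup>2 + (A\<^sup>2 - x\<^sup>2) * c\<^sup>2 = (1 - c\<^sup>2) * (x\<^sup>2 + c0\<^sup>2)"
    using eq by (simp add: algebra_simps)
  then have ln_eq: "ln (x\<^sup>2 + (A\<^sup>2 - x\<^sup>2) * c\<^sup>2) = ln (1 - c\<^sup>2) + ln (x\<^sup>2 + c0\<^sup>2)"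
    using c1 sum_squares_pos[OF c0, of x] by (simp only: ln_mult_pos)
  show "ln (x\<^sup>2 + c0\<^sup>2) / 2 - interval_log_potential A c x = - ln (1 - c\<^sup>2) / 2" if "\<bar>x\<bar> \<le> A"
    using that ln_eq by (simp add: interval_log_potential_def add_divide_distrib)
  assume x: "\<bar>x\<bar> > A"
  define s where "s = sqrt (x\<^sup>2 - A\<^sup>2)"
  have x2: "x\<^sup>2 > A\<^sup>2" using power_strict_mono[of A "\<bar>x\<bar>" 2] A x by simp
  then have s: "s > 0" "s\<^sup>2 = x\<^sup>2 - A\<^sup>2" by (simp_all add: s_def)
  have "s < \<bar>x\<bar>" using s A x2 power2_less_imp_less[of s "\<bar>x\<bar>"] by simp
  moreover have "c * s \<le> 1 * s" using c s by (intro mult_right_mono) auto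
  moreover have "0 \<le> c * s" using c s by simp
  ultimately have p: "\<bar>x\<bar> - c * s > 0" "\<bar>x\<bar> + c * s > 0" by linarith+
  have "x\<^sup>2 + (A\<^sup>2 - x\<^sup>2) * c\<^sup>2 = \<bar>x\<bar>\<^sup>2 - (c * s)\<^sup>2" by (simp add: power_mult_distrib s algebra_simps)
  also have "\<dots> = (\<bar>x\<bar> - c * s) * (\<bar>x\<bar> + c * s)" by (simp only: power2_eq_square algebra_simps)
  finally have "ln (1 - c\<^sup>2) + ln (x\<^sup>2 + c0\<^sup>2) = ln (\<bar>x\<bar> - c * s) + ln (\<bar>x\<bar> + c * s)"
    using p ln_eq by (simp only: ln_mult_pos)
  then have "ln (x\<^sup>2 + c0\<^sup>2) / 2 - ln (\<bar>x\<bar> + c * s)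
      = - ln (1 - c\<^sup>2) / 2 + (ln (\<bar>x\<bar> - c * s) - ln (\<bar>x\<bar> + c * s)) / 2"
    by (simp add: field_simps)
  then show "ln (x\<^sup>2 + c0\<^sup>2) / 2 - interval_log_potential A c x
      = - ln (1 - c\<^sup>2) / 2 + (ln (\<bar>x\<bar> - c * sqrt (x\<^sup>2 - A\<^sup>2)) - ln (\<bar>x\<bar> + c * sqrt (x\<^sup>2 - A\<^sup>2))) / 2"
    using x by (simp add: interval_log_potential_def s_def[symmetric])
qed

section \<open>Parameters of the supercritical case\<close>

locale supercritical =
  fixes a b :: real
  assumes a: "a > 0" and b: "b \<ge> 1" and gt: "a_cr b < ereal a"
begin

definition \<Delta> :: real where "\<Delta> = (b\<^sup>2 * a + a + 1) * (b\<^sup>2 * a - a - 1)"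
text \<open>The common value of \<open>(1 + a) * c\<^sub>1\<close> and \<open>a * c\<^sub>2\<close>.
  Matching the poles of the density gives the scales (1 / b) / sqrt (A^2 + 1 / b^2) and b / sqrt
  (A^2 + b^2). Their weighted values must agree, since otherwise the pulled back density would decay
  only like t^(-2) and the density would have inverse square root singularities at the endpoints.
  Solving this equation for A gives \<open>cut_endpoint\<close>.\<close>

definition \<theta> :: real where "\<theta> = sqrt (\<Delta> / (b ^ 4 - 1))"

abbreviation A :: real where "A \<equiv> cut_endpoint a b"
abbreviation c\<^sub>1 :: real where "c\<^sub>1 \<equiv> \<theta> / (1 + a)"
abbreviation c\<^sub>2 :: real where "c\<^sub>2 \<equiv> \<theta> / a"

lemma b_gt: "b > 1"
  using b gt by (cases "b = 1") (auto simp: a_cr_def)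

lemma factors_pos: "b\<^sup>2 * a - a - 1 > 0" "b\<^sup>2 * a + a + 1 > 0" "b ^ 4 - 1 > 0"
proof -
  have "b\<^sup>2 > 1" using b_gt by (simp add: one_less_power)
  with b_gt gt show "b\<^sup>2 * a - a - 1 > 0" by (simp add: a_cr_def field_simps)
  show "b\<^sup>2 * a + a + 1 > 0" using a by (intro add_pos_pos mult_pos_pos) (use b_gt in auto)
  show "b ^ 4 - 1 > 0" using b_gt by (simp add: one_less_power)
qed

lemma \<Delta>_pos: "\<Delta> > 0"
  using factors_pos by (simp add: \<Delta>_def)

lemma \<theta>_pos: "\<theta> > 0" and \<theta>_square: "\<theta>\<^sup>2 * (b ^ 4 - 1) = \<Delta>"
  using \<Delta>_pos factors_pos by (simp_all add: \<theta>_def)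

lemma endpoint_pos: "A > 0"
  unfolding cut_endpoint_def using a b_gt factors_pos by (intro divide_pos_pos mult_pos_pos) auto

lemma endpoint_square: "A\<^sup>2 * \<Delta> = b\<^sup>2 * (1 + 2 * a)"
  using a factors_pos by (simp add: cut_endpoint_def \<Delta>_def power_divide power_mult_distrib)

lemma \<Delta>_eq: "\<Delta> = b ^ 4 * a\<^sup>2 - (a + 1)\<^sup>2"
  by (simp add: \<Delta>_def power2_eq_square power4_eq_xxxx algebra_simps)

text \<open>Clears the denominators, so that the two pole relations for the scales become polynomial
  identities.\<close>

lemma endpoint_square_plus: "(A\<^sup>2 + b\<^sup>2) * \<Delta> = b\<^sup>2 * a\<^sup>2 * (b ^ 4 - 1)"
    "(A\<^sup>2 + 1 / b\<^sup>2) * \<Delta> * b\<^sup>2 = (b ^ 4 - 1) * (1 + a)\<^sup>2"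
proof -
  have "(A\<^sup>2 + b\<^sup>2) * \<Delta> = b\<^sup>2 * (1 + 2 * a) + b\<^sup>2 * \<Delta>" by (simp add: distrib_right endpoint_square)
  also have "\<dots> = b\<^sup>2 * a\<^sup>2 * (b ^ 4 - 1)"
    unfolding \<Delta>_eq by (simp add: power2_eq_square power4_eq_xxxx algebra_simps)
  finally show "(A\<^sup>2 + b\<^sup>2) * \<Delta> = b\<^sup>2 * a\<^sup>2 * (b ^ 4 - 1)" .
  have "(A\<^sup>2 + 1 / b\<^sup>2) * \<Delta> * b\<^sup>2 = b\<^sup>2 * (A\<^sup>2 * \<Delta>) + \<Delta>"
    using b_gt by (simp add: distrib_right distrib_left)
  also have "\<dots> = b\<^sup>2 * (b\<^sup>2 * (1 + 2 * a)) + \<Delta>"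
    by (simp only: endpoint_square)
  also have "\<dots> = (b ^ 4 - 1) * (1 + a)\<^sup>2"
    unfolding \<Delta>_eq by (simp add: power2_eq_square power4_eq_xxxx algebra_simps)
  finally show "(A\<^sup>2 + 1 / b\<^sup>2) * \<Delta> * b\<^sup>2 = (b ^ 4 - 1) * (1 + a)\<^sup>2" .
qed

lemma c\<^sub>1_eq: "c\<^sub>1\<^sup>2 * (A\<^sup>2 + (1 / b)\<^sup>2) = (1 / b)\<^sup>2"
proof -
  have "c\<^sub>1\<^sup>2 * (A\<^sup>2 + 1 / b\<^sup>2) * ((b ^ 4 - 1) * (1 + a)\<^sup>2 * b\<^sup>2)
      = (\<theta>\<^sup>2 * (b ^ 4 - 1)) * (A\<^sup>2 + 1 / b\<^sup>2) * b\<^sup>2"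
    using a by (simp add: power_divide)
  also have "\<dots> = (b ^ 4 - 1) * (1 + a)\<^sup>2"
    unfolding \<theta>_square using endpoint_square_plus(2) by (simp add: mult_ac)
  also have "\<dots> = 1 / b\<^sup>2 * ((b ^ 4 - 1) * (1 + a)\<^sup>2 * b\<^sup>2)" using b_gt by simp
  finally have "c\<^sub>1\<^sup>2 * (A\<^sup>2 + 1 / b\<^sup>2) = 1 / b\<^sup>2"
    using less_imp_neq[OF factors_pos(3)] a b_gt by (subst (asm) mult_right_cancel) auto
  then show ?thesis by (simp add: power_divide)
qed

lemma c\<^sub>2_eq: "c\<^sub>2\<^sup>2 * (A\<^sup>2 + b\<^sup>2) = b\<^sup>2"
proof -
  have "c\<^sub>2\<^sup>2 * (A\<^sup>2 + b\<^sup>2) * ((b ^ 4 - 1) * a\<^sup>2) = (\<theta>\<^sup>2 * (b ^ 4 - 1)) * (A\<^sup>2 + b\<^sup>2)"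
    using a by (simp add: power_divide)
  also have "\<dots> = b\<^sup>2 * ((b ^ 4 - 1) * a\<^sup>2)"
    unfolding \<theta>_square using endpoint_square_plus(1) by (simp add: mult_ac)
  finally show ?thesis
    using factors_pos a by (subst (asm) mult_right_cancel) auto
qed

text \<open>The order of the scales follows from a < 1 + a and is what the comparison outside the
  interval needs; \<open>c\<^sub>2 < 1\<close> holds because its square is b^2 / (A^2 +
  b^2).\<close>

lemma c_bounds: "0 < c\<^sub>1" "c\<^sub>1 < c\<^sub>2" "c\<^sub>2 < 1" "0 < c\<^sub>2" "c\<^sub>1 < 1"
proof -
  show "0 < c\<^sub>1" "0 < c\<^sub>2" using \<theta>_pos a by auto
  show *: "c\<^sub>1 < c\<^sub>2" using \<theta>_pos a by (intro divide_strict_left_mono) auto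
  show "c\<^sub>2 < 1"
  proof (rule ccontr)
    assume "\<not> c\<^sub>2 < 1"
    then have "1\<^sup>2 \<le> c\<^sub>2\<^sup>2" by (intro power_mono) auto
    then have "1 * (A\<^sup>2 + b\<^sup>2) \<le> c\<^sub>2\<^sup>2 * (A\<^sup>2 + b\<^sup>2)" by (intro mult_right_mono) auto
    with endpoint_pos show False unfolding c\<^sub>2_eq by simp
  qed
  with * show "c\<^sub>1 < 1" by simp
qed

lemma cut_constant_eq: "sqrt (cut_constant a b) = \<theta> * (b ^ 4 - 1) / b\<^sup>2"
proof (rule real_sqrt_unique)
  have "(\<theta> * (b ^ 4 - 1) / b\<^sup>2)\<^sup>2 = (\<theta>\<^sup>2 * (b ^ 4 - 1)) * (b ^ 4 - 1) / b ^ 4"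
    by (simp add: power_divide power_mult_distrib power_mult[symmetric] power2_eq_square[of "b ^ 4 - 1"])
  then show "(\<theta> * (b ^ 4 - 1) / b\<^sup>2)\<^sup>2 = cut_constant a b"
    unfolding \<theta>_square by (simp add: cut_constant_def \<Delta>_def mult_ac)
  show "0 \<le> \<theta> * (b ^ 4 - 1) / b\<^sup>2" using \<theta>_pos factors_pos by simp
qed

definition line_density :: "real \<Rightarrow> real" where
  "line_density t = (1 + a) * cauchy_density c\<^sub>1 t - a * cauchy_density c\<^sub>2 t"

text \<open>The powers of \<open>s\<close> cancel: the Jacobian and the square root supply
  \<open>s\<close> to the power -4, the two denominators supply the power 4. What remains is a
  constant over the product of t^2 + c1^2 and t^2 + c2^2, to be split into partial
  fractions.\<close>

lemma line_density_eq:
  "line_density t = A / (sqrt (1 + t\<^sup>2)) ^ 3 * cut_density a b (line_to_interval A t)"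
proof -
  define s where "s = sqrt (1 + t\<^sup>2)"
  have s: "s > 0" "s\<^sup>2 = 1 + t\<^sup>2" by (simp_all add: s_def less_imp_le)
  define y where "y = line_to_interval A t"
  have y: "y \<in> {-A<..<A}" unfolding y_def using range_line_to_interval[OF endpoint_pos] by auto
  have y2: "y\<^sup>2 = A\<^sup>2 * t\<^sup>2 / s\<^sup>2" by (simp add: y_def line_to_interval_square s)
  have "A\<^sup>2 - y\<^sup>2 = (A / s)\<^sup>2"
    unfolding y2 power_divide using s by (simp add: field_simps)
  then have r: "sqrt (A\<^sup>2 - y\<^sup>2) = A / s" using endpoint_pos s by simp
  define E F where "E = A\<^sup>2 + b\<^sup>2" and "F = A\<^sup>2 + 1 / b\<^sup>2"
  have EF: "E > 0" "F > 0" unfolding E_def F_def using endpoint_pos by (auto intro: add_pos_nonneg)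
  define p q where "p = t\<^sup>2 + c\<^sub>1\<^sup>2" and "q = t\<^sup>2 + c\<^sub>2\<^sup>2"
  have pq: "p > 0" "q > 0" unfolding p_def q_def using c_bounds by (auto intro: sum_squares_pos)
  have yb: "y\<^sup>2 + b\<^sup>2 = E * q / s\<^sup>2"
  proof -
    have "E * q = A\<^sup>2 * t\<^sup>2 + b\<^sup>2 * t\<^sup>2 + c\<^sub>2\<^sup>2 * (A\<^sup>2 + b\<^sup>2)" by (simp add: E_def q_def algebra_simps)
    also have "\<dots> = A\<^sup>2 * t\<^sup>2 + b\<^sup>2 * s\<^sup>2" unfolding c\<^sub>2_eq s(2) by (simp add: algebra_simps)
    finally show ?thesis using s(1) by (simp add: y2 add_divide_distrib)
  qed
  have yb': "y\<^sup>2 + 1 / b\<^sup>2 = F * p / s\<^sup>2"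
  proof -
    have "F * p = A\<^sup>2 * t\<^sup>2 + (1 / b)\<^sup>2 * t\<^sup>2 + c\<^sub>1\<^sup>2 * (A\<^sup>2 + (1 / b)\<^sup>2)"
      by (simp add: F_def p_def power_one_over algebra_simps)
    also have "\<dots> = A\<^sup>2 * t\<^sup>2 + (1 / b)\<^sup>2 * s\<^sup>2" unfolding c\<^sub>1_eq s(2) by (simp add: algebra_simps)
    finally show ?thesis using s(1) by (simp add: y2 add_divide_distrib power_one_over)
  qed
  have "A / s ^ 3 * cut_density a b y
     = A / s ^ 3 * (\<theta> * (b ^ 4 - 1) / b\<^sup>2 * (A / s) / (pi * (E * q / s\<^sup>2) * (F * p / s\<^sup>2)))"
    using y by (simp add: cut_density_def cut_constant_eq r yb yb')
  also have "\<dots> = A\<^sup>2 * \<theta> * (b ^ 4 - 1) / (b\<^sup>2 * E * F) / (pi * p * q)"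
    using s(1) EF pq b_gt by (simp add: field_simps power2_eq_square power3_eq_cube)
  \<comment> \<open>The normalising constant has to match the difference of the two denominators,
    which is the factor arising in the partial fractions.\<close>
  also have "A\<^sup>2 * \<theta> * (b ^ 4 - 1) / (b\<^sup>2 * E * F) = \<theta> * (c\<^sub>2\<^sup>2 - c\<^sub>1\<^sup>2)"
  proof -
    define B where "B = b ^ 4 - 1"
    have B: "B > 0" using factors_pos by (simp add: B_def)
    have "E = b\<^sup>2 * a\<^sup>2 * B / \<Delta>" "F = B * (1 + a)\<^sup>2 / (\<Delta> * b\<^sup>2)" "A\<^sup>2 = b\<^sup>2 * (1 + 2 * a) / \<Delta>"
      using endpoint_square_plus endpoint_square \<Delta>_pos b_gt
      by (simp_all add: E_def F_def B_def eq_divide_eq mult_ac)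
    then have "A\<^sup>2 * \<theta> * B / (b\<^sup>2 * E * F)
        = (b\<^sup>2 * (1 + 2 * a) / \<Delta>) * \<theta> * B / (b\<^sup>2 * (b\<^sup>2 * a\<^sup>2 * B / \<Delta>) * (B * (1 + a)\<^sup>2 / (\<Delta> * b\<^sup>2)))"
      by simp
    also have "\<dots> = \<theta> * (1 + 2 * a) * (\<Delta> / B) / (a\<^sup>2 * (1 + a)\<^sup>2)"
      using \<Delta>_pos B b_gt a by (simp add: divide_simps)
    also have "\<Delta> / B = \<theta>\<^sup>2" using B \<theta>_square by (simp add: B_def divide_eq_eq)
    also have "\<theta> * (1 + 2 * a) * \<theta>\<^sup>2 / (a\<^sup>2 * (1 + a)\<^sup>2) = \<theta> * (c\<^sub>2\<^sup>2 - c\<^sub>1\<^sup>2)"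
    proof -
      have "c\<^sub>2\<^sup>2 - c\<^sub>1\<^sup>2 = \<theta>\<^sup>2 * ((1 + a)\<^sup>2 - a\<^sup>2) / (a\<^sup>2 * (1 + a)\<^sup>2)"
        using a by (simp add: power_divide diff_frac_eq right_diff_distrib)
      also have "(1 + a)\<^sup>2 - a\<^sup>2 = 1 + 2 * a" by (simp add: power2_eq_square algebra_simps)
      finally show ?thesis by (simp add: mult_ac)
    qed
    finally show ?thesis by (simp add: B_def)
  qed
  also have "\<theta> * (c\<^sub>2\<^sup>2 - c\<^sub>1\<^sup>2) / (pi * p * q) = \<theta> / (pi * p) - \<theta> / (pi * q)"
  proof -
    have "c\<^sub>2\<^sup>2 - c\<^sub>1\<^sup>2 = q - p" by (simp add: p_def q_def)
    then show ?thesis using pq by (simp add: divide_simps) (simp add: algebra_simps)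
  qed
  also have "\<dots> = line_density t"
    using a by (simp add: line_density_def cauchy_density_def p_def q_def)
  finally show ?thesis by (simp add: s_def y_def)
qed

lemma cut_density_pos: "x \<in> {-A<..<A} \<Longrightarrow> cut_density a b x > 0"
  and cut_density_nonneg: "cut_density a b x \<ge> 0"
  and cut_density_zero: "x \<notin> {-A<..<A} \<Longrightarrow> cut_density a b x = 0"
proof -
  have den: "pi * (x\<^sup>2 + b\<^sup>2) * (x\<^sup>2 + 1 / b\<^sup>2) > 0"
    using sum_squares_pos[of b x] sum_squares_pos[of "1 / b" x] b_gt by (simp add: power_one_over)
  have C: "sqrt (cut_constant a b) > 0"
    unfolding cut_constant_eq using \<theta>_pos factors_pos b_gt by simp
  show pos: "cut_density a b x > 0" if "x \<in> {-A<..<A}"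
  proof -
    from that have "\<bar>x\<bar> < A" by auto
    then have "x\<^sup>2 < A\<^sup>2" using power_strict_mono[of "\<bar>x\<bar>" A 2] by simp
    then show ?thesis using that C den
      unfolding cut_density_def by (auto intro!: divide_pos_pos mult_pos_pos)
  qed
  show zero: "cut_density a b x = 0" if "x \<notin> {-A<..<A}"
  proof (cases "x \<in> {-A..A}")
    case True
    with that have "x = A \<or> x = - A" by auto
    then have "A\<^sup>2 - x\<^sup>2 = 0" by auto
    then show ?thesis by (simp add: cut_density_def)
  qed (auto simp: cut_density_def)
  show "cut_density a b x \<ge> 0" using pos zero by (cases "x \<in> {-A<..<A}") auto
qed

section \<open>Mass, effective potential and support on the interval\<close>

lemma borel_measurable_cut_density [measurable]: "cut_density a b \<in> borel_measurable borel"
  unfolding cut_density_def by measurable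

lemma has_bochner_integral_cut_density: "has_bochner_integral lborel (cut_density a b) 1"
proof -
  have "has_bochner_integral lborel line_density ((1 + a) * 1 - a * 1)"
    unfolding line_density_def[abs_def]
    by (intro has_bochner_integral_diff has_bochner_integral_mult_right has_bochner_integral_cauchy_density c_bounds)
  with has_bochner_integral_line_to_interval[OF endpoint_pos _ _ cut_density_zero line_density_eq, of "\<lambda>_. 1" 1]
  show ?thesis by simp
qed

definition cut_potential :: "real \<Rightarrow> real" where
  "cut_potential x = (1 + a) * (interval_log_potential A c\<^sub>1 x - ln (1 + c\<^sub>1))
     - a * (interval_log_potential A c\<^sub>2 x - ln (1 + c\<^sub>2))"

lemma has_bochner_integral_cut_potential:
  "has_bochner_integral lborel (\<lambda>y. cut_density a b y * ln \<bar>x - y\<bar>) (cut_potential x)"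
proof (rule has_bochner_integral_line_to_interval[OF endpoint_pos _ _ cut_density_zero line_density_eq])
  have "has_bochner_integral lborel
    (\<lambda>t. (1 + a) * (cauchy_density c\<^sub>1 t * ln \<bar>x - line_to_interval A t\<bar>)
       - a * (cauchy_density c\<^sub>2 t * ln \<bar>x - line_to_interval A t\<bar>)) (cut_potential x)"
    unfolding cut_potential_def
    by (intro has_bochner_integral_diff has_bochner_integral_mult_right
        cauchy_log_potential_line_to_interval endpoint_pos c_bounds)
  then show "has_bochner_integral lborel (\<lambda>t. line_density t * ln \<bar>x - line_to_interval A t\<bar>) (cut_potential x)"
    by (simp add: line_density_def algebra_simps)
qed simp_all

text \<open>The terms \<open>ln (1 + c\<^sub>1)\<close> and \<open>ln (1 + c\<^sub>2)\<close> stem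
  from the denominator 1 + t^2 of the substitution, the other two from the proportionality factors
  between the quadratic expressions and the arguments of the field.\<close>

definition robin_constant :: real where
  "robin_constant = (1 + a) * (ln (1 + c\<^sub>1) - ln (1 - c\<^sub>1\<^sup>2) / 2) - a * (ln (1 + c\<^sub>2) - ln (1 - c\<^sub>2\<^sup>2) / 2)"

lemma effective_potential:
  "\<bar>x\<bar> \<le> A \<Longrightarrow> external_field a b x - cut_potential x = robin_constant"
  "robin_constant \<le> external_field a b x - cut_potential x"
proof -
  have b0: "1 / b > 0" "b > 0" using b_gt by auto
  note w1 = ln_minus_interval_log_potential[OF c_bounds(1,5) b0(1) endpoint_pos c\<^sub>1_eq, of x]
  note w2 = ln_minus_interval_log_potential[OF c_bounds(4,3) b0(2) endpoint_pos c\<^sub>2_eq, of x]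
  have split: "external_field a b x - cut_potential x
     = (1 + a) * ((ln (x\<^sup>2 + (1 / b)\<^sup>2) / 2 - interval_log_potential A c\<^sub>1 x) + ln (1 + c\<^sub>1))
       - a * ((ln (x\<^sup>2 + b\<^sup>2) / 2 - interval_log_potential A c\<^sub>2 x) + ln (1 + c\<^sub>2))"
    unfolding external_field_eq cut_potential_def by (simp only: algebra_simps)
  show inside: "external_field a b x - cut_potential x = robin_constant" if "\<bar>x\<bar> \<le> A"
    unfolding split w1(1)[OF that] w2(1)[OF that] robin_constant_def by simp
  show "robin_constant \<le> external_field a b x - cut_potential x"
  proof (cases "\<bar>x\<bar> \<le> A")
    case False
    then have x: "\<bar>x\<bar> > A" by simp
    define s where "s = sqrt (x\<^sup>2 - A\<^sup>2)"
    define g where "g = (\<lambda>c. ln (\<bar>x\<bar> - c * s) - ln (\<bar>x\<bar> + c * s))"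
    have x2: "x\<^sup>2 > A\<^sup>2" using power_strict_mono[of A "\<bar>x\<bar>" 2] endpoint_pos x by simp
    then have s: "s > 0" "s\<^sup>2 = x\<^sup>2 - A\<^sup>2" by (simp_all add: s_def)
    have "s < \<bar>x\<bar>" using s endpoint_pos power2_less_imp_less[of s "\<bar>x\<bar>"] by simp
    moreover have "c\<^sub>2 * s \<le> 1 * s" using c_bounds s by (intro mult_right_mono) auto
    ultimately have "c\<^sub>2 * s < \<bar>x\<bar>" by linarith
    \<comment> \<open>The hypothesis on the products holds because both
      \<open>(1 + a) * c\<^sub>1\<close> and \<open>a * c\<^sub>2\<close> equal \<theta>. Half the
      difference of the two sides is the excess of the effective potential over its value on the
      interval.\<close>
    then have "a * g c\<^sub>2 \<le> (1 + a) * g c\<^sub>1"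
      unfolding g_def using s c_bounds a by (intro ln_ratio_comparison) auto
    moreover have "external_field a b x - cut_potential x
        = robin_constant + ((1 + a) * g c\<^sub>1 - a * g c\<^sub>2) / 2"
      unfolding split w1(2)[OF x] w2(2)[OF x] robin_constant_def s_def[symmetric] g_def
      by (simp add: field_simps)
    ultimately show ?thesis by simp
  qed (simp add: inside)
qed

lemma equilibrium: "is_equilibrium_measure (external_field a b) (density lborel (\<lambda>x. ennreal (cut_density a b x)))"
proof -
  obtain B where B: "\<And>x. \<bar>external_field a b x - ln_weight x\<bar> \<le> B"
    using external_field_minus_ln_weight_bounded[of a b] a b_gt by force
  show ?thesis
  proof (rule equilibrium_densityI[where l = robin_constant and f = cut_potential, OF _ B])
    fix x assume "cut_density a b x > 0"
    then have "x \<in> {-A<..<A}" using cut_density_zero[of x] by force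
    then show "external_field a b x - cut_potential x = robin_constant"
      by (intro effective_potential(1)) auto
  qed (use cut_density_nonneg has_bochner_integral_cut_density has_bochner_integral_cut_potential
        effective_potential(2) in auto)
qed

lemma support: "measure_support (density lborel (\<lambda>x. ennreal (cut_density a b x))) = {-A..A}"
proof -
  have cl: "closure {-A<..<A} = {-A..A}" using endpoint_pos by (intro closure_greaterThanLessThan) simp
  show ?thesis
    using measure_support_density[of "cut_density a b" "{-A<..<A}"] cut_density_pos cut_density_zero
    unfolding cl by force
qed

end

theorem theorem1p6:
  fixes a b :: real
  assumes "a > 0" and "b \<ge> 1"
  shows "(ereal a \<le> a_cr b \<longrightarrow>
            (\<forall>x. 0 \<le> full_density a b x) \<and>
            is_equilibrium_measure (external_field a b)
              (density lborel (\<lambda>x. ennreal (full_density a b x))) \<and>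
            measure_support (density lborel (\<lambda>x. ennreal (full_density a b x))) = UNIV)
       \<and> (a_cr b < ereal a \<longrightarrow>
            (\<forall>x. 0 \<le> cut_density a b x) \<and>
            is_equilibrium_measure (external_field a b)
              (density lborel (\<lambda>x. ennreal (cut_density a b x))) \<and>
            measure_support (density lborel (\<lambda>x. ennreal (cut_density a b x)))
              = {- cut_endpoint a b .. cut_endpoint a b})"
proof (intro conjI impI)
  assume le: "ereal a \<le> a_cr b"
  show "\<forall>x. 0 \<le> full_density a b x"
    using full_density_pos[OF assms le] by (auto intro: less_imp_le)
  show "is_equilibrium_measure (external_field a b) (density lborel (\<lambda>x. ennreal (full_density a b x)))"
    "measure_support (density lborel (\<lambda>x. ennreal (full_density a b x))) = UNIV"
    by (rule full_density_equilibrium[OF assms le])+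
next
  assume gt: "a_cr b < ereal a"
  interpret supercritical a b using assms gt by unfold_locales
  show "\<forall>x. 0 \<le> cut_density a b x" by (simp add: cut_density_nonneg)
  show "is_equilibrium_measure (external_field a b) (density lborel (\<lambda>x. ennreal (cut_density a b x)))"
    by (rule equilibrium)
  show "measure_support (density lborel (\<lambda>x. ennreal (cut_density a b x)))
      = {- cut_endpoint a b .. cut_endpoint a b}"
    by (rule support)
qed

end
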